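(* Let $f:\mathbb{R}^n\to\mathbb{R}$ be a $C^1$ function with monotonicity profile $\rho\in\{-1,0,1\}^n$ over a box $$B=\{(u_1,\ldots,u_n)\in\mathbb{R}^n : (b_i^+-u_i)(u_i-b_i^-)\ge0,\ i=1,\ldots,n\}.$$ For any $\epsilon>0$, there exist an integer $d$ and a polynomial $p$ of degree $d$ such that $$\max_{x\in B}|f(x)-p(x)|<\epsilon$$ and such that $p$ has the same monotonicity profile $\rho$ over $B$. Furthermore, this monotonicity profile of $p$ can be certified using sum of squares certificates.
   Context: Here $b_i^-\le b_i^+$ are real numbers. A differentiable function $f$ is monotonically increasing (resp. decreasing) over $B$ with respect to $x_j$ if $f(x_1,\ldots,x_j,\ldots,x_n)\le f(x_1,\ldots,y_j,\ldots,x_n)$ (resp. $\ge$) whenever both points lie in $B$ and $x_j\le y_j$ (equivalently, $\partial f/\partial x_j\ge0$, resp. $\le0$, on $B$). $f$ has monotonicity profile $\rho$ over $B$ if for each $j$ it is monotonically increasing with respect to $x_j$ when $\rho_j=1$, monotonically decreasing with respect to $x_j$ when $\rho_j=-1$, with no requirement when $\rho_j=0$. A sum of squares certificate for the monotonicity profile of a polynomial $p$ over $B$ consists, for each $j$ with $\rho_j\neq0$, of an identity $$\rho_j\frac{\partial p(x)}{\partial x_j}=\sigma_j^0(x)+\sum_{k=1}^n\sigma_j^k(x)(b_k^+-x_k)(x_k-b_k^-)$$ where all $\sigma_j^k$ are sums of squares of polynomials. *)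

theory Defs
  imports "HOL-Analysis.Analysis"
begin

definition C1_function :: "(real ^ 'n \<Rightarrow> real) \<Rightarrow> bool" where
  "C1_function f \<longleftrightarrow>
     (\<exists>f' :: real ^ 'n \<Rightarrow> ((real ^ 'n) \<Rightarrow>\<^sub>L real).
        (\<forall>x. (f has_derivative blinfun_apply (f' x)) (at x)) \<and> continuous_on UNIV f')"

definition partial_derivative :: "(real ^ 'n \<Rightarrow> real) \<Rightarrow> 'n \<Rightarrow> real ^ 'n \<Rightarrow> real" where
  "partial_derivative f j x = frechet_derivative f (at x) (axis j 1)"

definition constraint_box :: "real ^ 'n \<Rightarrow> real ^ 'n \<Rightarrow> (real ^ 'n) set" where
  "constraint_box bm bp = {u. \<forall>i. (bp $ i - u $ i) * (u $ i - bm $ i) \<ge> 0}"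

definition increasing_wrt :: "(real ^ 'n) set \<Rightarrow> 'n \<Rightarrow> (real ^ 'n \<Rightarrow> real) \<Rightarrow> bool" where
  "increasing_wrt B j f \<longleftrightarrow>
     (\<forall>x\<in>B. \<forall>y\<in>B. (\<forall>i. i \<noteq> j \<longrightarrow> x $ i = y $ i) \<and> x $ j \<le> y $ j \<longrightarrow> f x \<le> f y)"

definition decreasing_wrt :: "(real ^ 'n) set \<Rightarrow> 'n \<Rightarrow> (real ^ 'n \<Rightarrow> real) \<Rightarrow> bool" where
  "decreasing_wrt B j f \<longleftrightarrow>
     (\<forall>x\<in>B. \<forall>y\<in>B. (\<forall>i. i \<noteq> j \<longrightarrow> x $ i = y $ i) \<and> x $ j \<le> y $ j \<longrightarrow> f x \<ge> f y)"

definition has_monotonicity_profile ::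
    "(real ^ 'n) set \<Rightarrow> real ^ 'n \<Rightarrow> (real ^ 'n \<Rightarrow> real) \<Rightarrow> bool" where
  "has_monotonicity_profile B \<rho> f \<longleftrightarrow>
     (\<forall>j. (\<rho> $ j = 1 \<longrightarrow> increasing_wrt B j f) \<and> (\<rho> $ j = -1 \<longrightarrow> decreasing_wrt B j f))"

text \<open>
  Polynomials in n real variables are represented by the functions they induce on \<open>real ^ 'n\<close>
  (the library's \<^const>\<open>real_polynomial_function\<close>); over the reals the polynomial is determined
  by its function. The total degree is read off an expansion into distinct monomials with
  nonzero coefficients, which is therefore unique; the zero polynomial (empty expansion)
  is given degree 0.
\<close>

definition has_total_degree :: "(real ^ 'n \<Rightarrow> real) \<Rightarrow> nat \<Rightarrow> bool" where
  "has_total_degree p d \<longleftrightarrow>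
     (\<exists>(A :: ('n \<Rightarrow> nat) set) c.
        finite A \<and> (\<forall>\<alpha>\<in>A. c \<alpha> \<noteq> 0) \<and>
        (\<forall>x. p x = (\<Sum>\<alpha>\<in>A. c \<alpha> * (\<Prod>i\<in>UNIV. x $ i ^ \<alpha> i))) \<and>
        d = Max (insert 0 ((\<lambda>\<alpha>. \<Sum>i\<in>UNIV. \<alpha> i) ` A)))"

definition sum_of_squares :: "(real ^ 'n \<Rightarrow> real) \<Rightarrow> bool" where
  "sum_of_squares \<sigma> \<longleftrightarrow>
     (\<exists>(r :: nat) q. (\<forall>i<r. real_polynomial_function (q i)) \<and> (\<forall>x. \<sigma> x = (\<Sum>i<r. (q i x)\<^sup>2)))"

definition has_sos_monotonicity_certificate ::
    "real ^ 'n \<Rightarrow> real ^ 'n \<Rightarrow> real ^ 'n \<Rightarrow> (real ^ 'n \<Rightarrow> real) \<Rightarrow> bool" where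
  "has_sos_monotonicity_certificate bm bp \<rho> p \<longleftrightarrow>
     (\<forall>j. \<rho> $ j \<noteq> 0 \<longrightarrow>
        (\<exists>(\<sigma>0 :: real ^ 'n \<Rightarrow> real) (\<sigma> :: 'n \<Rightarrow> real ^ 'n \<Rightarrow> real).
           sum_of_squares \<sigma>0 \<and> (\<forall>k. sum_of_squares (\<sigma> k)) \<and>
           (\<forall>x. \<rho> $ j * partial_derivative p j x =
                  \<sigma>0 x + (\<Sum>k\<in>UNIV. \<sigma> k x * (bp $ k - x $ k) * (x $ k - bm $ k)))))"

end

theory Submission
  imports Defs "HOL-Computational_Algebra.Polynomial"
begin

text \<open>
The approximant is a Bernstein-like operator \<open>\<Sum>\<kappa>. F (y \<kappa>) (\<Prod>i. w i (\<kappa> i) (x i)) - M\<close>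
applied to \<open>F = f + M \<ge> 0\<close>, where \<open>\<kappa>\<close> runs over a grid with nodes \<open>y \<kappa>\<close> in the box and the
\<open>w i k\<close> are univariate polynomials. Bernstein's own operator preserves monotonicity, but its
derivatives involve products of several factors \<open>x i\<close> and \<open>1 - x i\<close>, which are nonnegative on the
box and yet carry no evident certificate that avoids products of constraints. The remedy is to
choose the weights differently: nonnegative on the whole line, hence sums of squares, and such that
each tail sum \<open>\<Sum>l\<ge>k. w i l\<close> is monotone on the \<open>i\<close>-th side of the box.

Differentiate with respect to \<open>x j\<close> and sum by parts in the index of coordinate \<open>j\<close>
(\<open>sum_by_parts_tail_sums\<close>). The derivative becomes a sum of products of three kinds of factor: a
difference \<open>F (y \<kappa>) - F (y \<kappa>')\<close> of values at neighbouring nodes (or a first value of \<open>F\<close>), which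
has the right sign because \<open>f\<close> is monotone in \<open>x j\<close>; weights in the other coordinates, which are
sums of squares; and the derivative of a tail sum in \<open>x j\<close>. The last is a univariate polynomial
with a sign on an interval, and such a polynomial is \<open>\<alpha> + \<beta> (b - t) (t - a)\<close> with \<open>\<alpha>\<close> and \<open>\<beta>\<close>
nonnegative on the line (\<open>interval_qm_nonneg_on_interval\<close>), that is, sums of squares
(\<open>sum_of_squares_nonneg_poly\<close>). Only the constraint of coordinate \<open>j\<close> occurs, so the product is a
certificate of the required form (\<open>tensor_sum_certificate\<close>).

Suitable weights are increments of a polynomial approximation of the step function, the
antiderivative of a Landau kernel (\<open>quasi_partition_unit\<close>). They sum to 1 only approximately and
concentrate near \<open>x\<close>, which suffices for uniform approximation of continuous functions
(\<open>tensor_sum_approximates\<close>).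
\<close>

section \<open>Factoring out minima of univariate polynomials\<close>

lemma poly_synthetic_div:
  fixes p :: "'a::comm_ring_1 poly"
  shows "poly p x = poly p r + (x - r) * poly (synthetic_div p r) x"
proof -
  have "poly p x = poly ([:-r, 1:] * synthetic_div p r + [:poly p r:]) x"
    by (simp only: synthetic_div_correct')
  then show ?thesis by (simp add: algebra_simps)
qed

text \<open>
A local minimum at \<open>r\<close> is a double root of \<open>p - p r\<close>. Splitting it off is the step by which both
nonnegativity certificates below are built: what remains is again nonnegative and has smaller degree.
\<close>

lemma poly_minimum_factor:
  fixes p :: "real poly"
  assumes "d > 0" and min: "\<And>x. \<bar>r - x\<bar> < d \<Longrightarrow> poly p r \<le> poly p x"
  obtains s where "\<And>x. poly p x = poly p r + (x - r)\<^sup>2 * poly s x" "degree s = degree p - 2"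
proof -
  define q where "q = synthetic_div p r"
  have q: "poly p x = poly p r + (x - r) * poly q x" for x
    unfolding q_def by (rule poly_synthetic_div)
  have "((\<lambda>x. poly p r + (x - r) * poly q x) has_real_derivative poly q r) (at r)"
    by (auto intro!: derivative_eq_intros)
  then have "(poly p has_real_derivative poly q r) (at r)"
    by (simp flip: q)
  then have "poly q r = 0"
    using DERIV_local_min[of "poly p" _ r d] assms by auto
  then have "poly p x = poly p r + (x - r)\<^sup>2 * poly (synthetic_div q r) x" for x
    using q[of x] poly_synthetic_div[of q x r] by (simp add: power2_eq_square)
  moreover have "degree (synthetic_div q r) = degree p - 2"
    by (simp add: degree_synthetic_div q_def)
  ultimately show ?thesis by (rule that)
qed

text \<open>
The cofactor left after removing a root is seen to be nonnegative only away from that root; this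
closes the gap by continuity.
\<close>

lemma poly_nonneg_at_excluded_point:
  fixes s :: "real poly"
  assumes "a < b" and r: "r \<in> {a..b}" and pos: "\<And>x. x \<in> {a..b} \<Longrightarrow> x \<noteq> r \<Longrightarrow> poly s x \<ge> 0"
  shows "poly s r \<ge> 0"
proof (rule tendsto_lowerbound)
  show "(poly s \<longlongrightarrow> poly s r) (at r within {a..b})"
    using poly_isCont[of r s] by (auto simp: isCont_def intro: tendsto_within_subset)
  show "\<forall>\<^sub>F x in at r within {a..b}. 0 \<le> poly s x"
    using pos by (auto simp: eventually_at_filter)
  show "at r within {a..b} \<noteq> bot"
    using assms by (simp add: trivial_limit_within islimpt_Icc)
qed

lemma nonneg_poly_attains_minimum:
  fixes p :: "real poly"
  assumes nonneg: "\<And>x. poly p x \<ge> 0"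
  obtains r where "\<And>x. poly p r \<le> poly p x"
proof (cases "degree p = 0")
  case True
  then obtain c where "p = [:c:]" by (rule degree_eq_zeroE)
  then show ?thesis using that by auto
next
  case False
  then have "filterlim (poly p) at_infinity at_infinity"
    by (intro filterlim_poly_at_infinity) auto
  then have "\<forall>\<^sub>F x in at_infinity. poly p 0 + 1 \<le> norm (poly p x)"
    using filterlim_at_infinity[of 0 "poly p"] nonneg[of 0] by auto
  then obtain R where R: "\<And>x. R \<le> \<bar>x\<bar> \<Longrightarrow> poly p 0 \<le> poly p x"
    using nonneg by (force simp: eventually_at_infinity)
  have "\<exists>r\<in>cball 0 \<bar>R\<bar>. \<forall>x\<in>cball 0 \<bar>R\<bar>. poly p r \<le> poly p x"
    by (intro continuous_attains_inf) (auto intro!: continuous_intros)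
  then obtain r where r: "r \<in> cball 0 \<bar>R\<bar>" "\<And>x. x \<in> cball 0 \<bar>R\<bar> \<Longrightarrow> poly p r \<le> poly p x"
    by blast
  show ?thesis
  proof (rule that)
    fix x
    show "poly p r \<le> poly p x"
      using r(2)[of x] r(2)[of 0] R[of x] abs_ge_self[of R]
      by (cases "x \<in> cball 0 \<bar>R\<bar>") auto
  qed
qed

section \<open>Sums of squares\<close>

lemma sum_of_squaresE:
  fixes \<sigma> :: "real^'n \<Rightarrow> real"
  assumes "sum_of_squares \<sigma>"
  obtains r :: nat and q :: "nat \<Rightarrow> real^'n \<Rightarrow> real" where "\<forall>i<r. real_polynomial_function (q i)" "\<And>x. \<sigma> x = (\<Sum>i<r. (q i x)\<^sup>2)"
  using assms unfolding sum_of_squares_def by blast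

lemma sum_of_squares_add:
  fixes \<sigma> \<tau> :: "real^'n \<Rightarrow> real"
  assumes "sum_of_squares \<sigma>" "sum_of_squares \<tau>"
  shows "sum_of_squares (\<lambda>x. \<sigma> x + \<tau> x)"
proof -
  obtain r :: nat and q :: "nat \<Rightarrow> real^'n \<Rightarrow> real" where q: "\<forall>i<r. real_polynomial_function (q i)" "\<And>x. \<sigma> x = (\<Sum>i<r. (q i x)\<^sup>2)"
    using assms(1) by (elim sum_of_squaresE) (rule that)
  obtain r' :: nat and q' :: "nat \<Rightarrow> real^'n \<Rightarrow> real" where q': "\<forall>i<r'. real_polynomial_function (q' i)" "\<And>x. \<tau> x = (\<Sum>i<r'. (q' i x)\<^sup>2)"
    using assms(2) by (elim sum_of_squaresE) (rule that)
  have "(\<Sum>i<r+n. ((if i < r then q i else q' (i - r)) x)\<^sup>2) = (\<Sum>i<r. (q i x)\<^sup>2) + (\<Sum>i<n. (q' i x)\<^sup>2)" for n x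
    by (induction n) auto
  then show ?thesis using q q' unfolding sum_of_squares_def
    by (intro exI[of _ "r + r'"] exI[of _ "\<lambda>i. if i < r then q i else q' (i - r)"]) auto
qed

lemma sum_of_squares_square:
  assumes "real_polynomial_function q"
  shows "sum_of_squares (\<lambda>x. (q x)\<^sup>2)"
  unfolding sum_of_squares_def using assms by (intro exI[of _ 1] exI[of _ "\<lambda>_. q"]) auto

lemma sum_of_squares_const:
  assumes "c \<ge> 0" shows "sum_of_squares (\<lambda>x. c)"
  using sum_of_squares_square[of "\<lambda>x. sqrt c"] assms by (simp add: real_polynomial_function.intros(2))

lemma sum_of_squares_sum:
  assumes "finite I" "\<And>i. i \<in> I \<Longrightarrow> sum_of_squares (\<sigma> i)"
  shows "sum_of_squares (\<lambda>x. \<Sum>i\<in>I. \<sigma> i x)"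
  using assms by (induction I) (auto intro: sum_of_squares_add sum_of_squares_const)

lemma sum_of_squares_mult:
  fixes \<sigma> \<tau> :: "real^'n \<Rightarrow> real"
  assumes "sum_of_squares \<sigma>" "sum_of_squares \<tau>"
  shows "sum_of_squares (\<lambda>x. \<sigma> x * \<tau> x)"
proof -
  obtain r :: nat and q :: "nat \<Rightarrow> real^'n \<Rightarrow> real" where q: "\<forall>i<r. real_polynomial_function (q i)" "\<And>x. \<sigma> x = (\<Sum>i<r. (q i x)\<^sup>2)"
    using assms(1) by (elim sum_of_squaresE) (rule that)
  obtain r' :: nat and q' :: "nat \<Rightarrow> real^'n \<Rightarrow> real" where q': "\<forall>i<r'. real_polynomial_function (q' i)" "\<And>x. \<tau> x = (\<Sum>i<r'. (q' i x)\<^sup>2)"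
    using assms(2) by (elim sum_of_squaresE) (rule that)
  have "sum_of_squares (\<lambda>x. \<Sum>i<r. \<Sum>j<r'. (q i x * q' j x)\<^sup>2)"
    using q(1) q'(1)
    by (intro sum_of_squares_sum sum_of_squares_square real_polynomial_function.intros(4)) auto
  then show ?thesis
    by (simp add: q(2) q'(2) sum_product power_mult_distrib)
qed

lemma sum_of_squares_prod:
  assumes "finite I" "\<And>i. i \<in> I \<Longrightarrow> sum_of_squares (\<sigma> i)"
  shows "sum_of_squares (\<lambda>x. \<Prod>i\<in>I. \<sigma> i x)"
  using assms by (induction I) (auto intro: sum_of_squares_mult sum_of_squares_const)

lemma real_polynomial_function_component: "real_polynomial_function (\<lambda>x::real^'n. x $ i)"
  by (intro real_polynomial_function.intros(1) bounded_linear_vec_nth)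

text \<open>
A univariate polynomial that is nonnegative on the line attains its minimum \<open>m\<close> at some \<open>r\<close>, so it is
\<open>m + (x - r)\<^sup>2 s\<close> with \<open>s\<close> nonnegative, and induction on the degree applies. The claim is phrased
for the polynomial in one coordinate, which is how it is used.
\<close>

lemma sum_of_squares_nonneg_poly:
  assumes "\<And>t. poly p t \<ge> 0"
  shows "sum_of_squares (\<lambda>x::real^'n. poly p (x $ i))"
  using assms
proof (induction "degree p" arbitrary: p rule: less_induct)
  case less
  obtain r where r: "\<And>x. poly p r \<le> poly p x"
    using nonneg_poly_attains_minimum less.prems by blast
  show ?case
  proof (cases "degree p = 0")
    case True
    then obtain c where "p = [:c:]" by (rule degree_eq_zeroE)
    then show ?thesis using less.prems by (auto intro: sum_of_squares_const)
  next
    case False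
    obtain s where s: "\<And>x. poly p x = poly p r + (x - r)\<^sup>2 * poly s x" "degree s = degree p - 2"
      using poly_minimum_factor[of 1 r p] r by auto
    have away: "poly s x \<ge> 0" if "x \<noteq> r" for x
      using r[of x] s(1)[of x] that by (auto simp: zero_le_mult_iff)
    have "poly s x \<ge> 0" for x
      using poly_nonneg_at_excluded_point[of r "r + 1" r s] away by (cases "x = r") auto
    then have "sum_of_squares (\<lambda>x::real^'n. poly s (x $ i))"
      using less.hyps[of s] s(2) False by auto
    moreover have "sum_of_squares (\<lambda>x::real^'n. (x $ i - r)\<^sup>2)"
      by (intro sum_of_squares_square real_polynomial_function_diff
          real_polynomial_function_component real_polynomial_function.intros(2))
    ultimately have "sum_of_squares (\<lambda>x::real^'n. poly p r + (x $ i - r)\<^sup>2 * poly s (x $ i))"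
      using less.prems by (intro sum_of_squares_add sum_of_squares_mult sum_of_squares_const) auto
    then show ?thesis by (simp flip: s(1))
  qed
qed

section \<open>Nonnegative polynomials on an interval\<close>

text \<open>
For one variable a square summand may be replaced by a polynomial that is nonnegative on the line,
so this is the quadratic module of the single constraint \<open>(b - t) (t - a) \<ge> 0\<close>. Its elements are
kept as functions so that sums and products of members need no polynomial arithmetic.
\<close>

definition interval_quadratic_module :: "real \<Rightarrow> real \<Rightarrow> (real \<Rightarrow> real) set" where
  "interval_quadratic_module a b =
     {q. \<exists>\<alpha> \<beta>. (\<forall>t. poly \<alpha> t \<ge> 0) \<and> (\<forall>t. poly \<beta> t \<ge> 0) \<and>
          (\<forall>t. q t = poly \<alpha> t + poly \<beta> t * ((b - t) * (t - a)))}"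

lemma interval_qmI:
  assumes "\<And>t. poly \<alpha> t \<ge> 0" "\<And>t. poly \<beta> t \<ge> 0"
    "\<And>t. q t = poly \<alpha> t + poly \<beta> t * ((b - t) * (t - a))"
  shows "q \<in> interval_quadratic_module a b"
  unfolding interval_quadratic_module_def using assms by blast

lemma interval_qmE:
  assumes "q \<in> interval_quadratic_module a b"
  obtains \<alpha> \<beta> :: "real poly" where "\<And>t. poly \<alpha> t \<ge> 0" "\<And>t. poly \<beta> t \<ge> 0"
    "\<And>t. q t = poly \<alpha> t + poly \<beta> t * ((b - t) * (t - a))"
  using assms unfolding interval_quadratic_module_def by blast

lemma interval_qm_nonneg_poly: "(\<And>t. poly p t \<ge> 0) \<Longrightarrow> poly p \<in> interval_quadratic_module a b"
  by (rule interval_qmI[of p 0]) auto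

lemma interval_qm_const: "c \<ge> 0 \<Longrightarrow> (\<lambda>t. c) \<in> interval_quadratic_module a b"
  by (rule interval_qmI[of "[:c:]" 0]) auto

text \<open>
With only one generator \<open>g\<close> a quadratic module is closed under products, because the cross term
\<open>g\<^sup>2\<close> is a square. For several generators this fails in general, which is why only one coordinate at a time may
contribute a nontrivial member below.
\<close>

lemma interval_qm_mult:
  assumes "p \<in> interval_quadratic_module a b" "q \<in> interval_quadratic_module a b"
  shows "(\<lambda>t. p t * q t) \<in> interval_quadratic_module a b"
proof -
  obtain \<alpha> \<beta> :: "real poly" where 1: "\<And>t. poly \<alpha> t \<ge> 0" "\<And>t. poly \<beta> t \<ge> 0"
      "\<And>t. p t = poly \<alpha> t + poly \<beta> t * ((b - t) * (t - a))"
    using assms(1) by (elim interval_qmE) (rule that)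
  obtain \<gamma> \<delta> :: "real poly" where 2: "\<And>t. poly \<gamma> t \<ge> 0" "\<And>t. poly \<delta> t \<ge> 0"
      "\<And>t. q t = poly \<gamma> t + poly \<delta> t * ((b - t) * (t - a))"
    using assms(2) by (elim interval_qmE) (rule that)
  define g where "g = [:b, -1:] * [:-a, 1:]"
  have g: "poly g t = (b - t) * (t - a)" for t by (simp add: g_def algebra_simps)
  show ?thesis
  proof (rule interval_qmI)
    show "poly (\<alpha> * \<gamma> + \<beta> * \<delta> * g\<^sup>2) t \<ge> 0" "poly (\<alpha> * \<delta> + \<beta> * \<gamma>) t \<ge> 0" for t
      using 1(1,2) 2(1,2) by (simp_all add: poly_power)
    show "p t * q t = poly (\<alpha> * \<gamma> + \<beta> * \<delta> * g\<^sup>2) t + poly (\<alpha> * \<delta> + \<beta> * \<gamma>) t * ((b - t) * (t - a))" for t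
      unfolding 1(3) 2(3) g[symmetric] by (simp add: poly_power power2_eq_square ring_distribs mult_ac)
  qed
qed

lemma interval_qm_add:
  assumes "p \<in> interval_quadratic_module a b" "q \<in> interval_quadratic_module a b"
  shows "(\<lambda>t. p t + q t) \<in> interval_quadratic_module a b"
proof -
  obtain \<alpha> \<beta> :: "real poly" where 1: "\<And>t. poly \<alpha> t \<ge> 0" "\<And>t. poly \<beta> t \<ge> 0"
      "\<And>t. p t = poly \<alpha> t + poly \<beta> t * ((b - t) * (t - a))"
    using assms(1) by (elim interval_qmE) (rule that)
  obtain \<gamma> \<delta> :: "real poly" where 2: "\<And>t. poly \<gamma> t \<ge> 0" "\<And>t. poly \<delta> t \<ge> 0"
      "\<And>t. q t = poly \<gamma> t + poly \<delta> t * ((b - t) * (t - a))"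
    using assms(2) by (elim interval_qmE) (rule that)
  show ?thesis
    by (rule interval_qmI[of "\<alpha> + \<gamma>" "\<beta> + \<delta>"]) (simp_all add: 1 2 distrib_right)
qed

lemma interval_qm_sum:
  assumes "finite I" "\<And>i. i \<in> I \<Longrightarrow> q i \<in> interval_quadratic_module a b"
  shows "(\<lambda>t. \<Sum>i\<in>I. q i t) \<in> interval_quadratic_module a b"
  using assms by (induction I) (auto intro: interval_qm_add interval_qm_const)

text \<open>
The identity behind both claims is \<open>(t - a) (b - a) = (t - a)\<^sup>2 + (b - t) (t - a)\<close> and its mirror image.
\<close>

lemma interval_qm_endpoint_factors:
  assumes "a < b"
  shows "(\<lambda>t. t - a) \<in> interval_quadratic_module a b" "(\<lambda>t. b - t) \<in> interval_quadratic_module a b"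
proof -
  have *: "poly (smult (1 / (b - a)) ([:-c, 1:]\<^sup>2)) t = (t - c)\<^sup>2 / (b - a)" for c t
    by (simp add: poly_power)
  have nonneg: "poly (smult (1 / (b - a)) ([:-c, 1:]\<^sup>2)) t \<ge> 0" "poly [:1 / (b - a):] t \<ge> 0" for c t
    using assms by (simp_all add: *)
  have "t - a = (t - a)\<^sup>2 / (b - a) + 1 / (b - a) * ((b - t) * (t - a))"
       "b - t = (t - b)\<^sup>2 / (b - a) + 1 / (b - a) * ((b - t) * (t - a))" for t
    using assms by (simp_all add: divide_simps) (simp_all add: algebra_simps power2_eq_square)
  then show "(\<lambda>t. t - a) \<in> interval_quadratic_module a b"
    "(\<lambda>t. b - t) \<in> interval_quadratic_module a b"
    by (auto intro!: interval_qmI[OF nonneg] simp only: * poly_pCons poly_0 mult_zero_right add_0_right)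
qed

text \<open>
The positivity certificate on an interval, by induction on the degree: after subtracting the
minimum over the interval, a minimizer at an endpoint splits off a linear factor that belongs to
the module, and a minimizer in the interior splits off a square. Strict inequality of the endpoints
is essential: on a single point \<open>a\<close>, the polynomial \<open>t - a\<close> has no certificate.
\<close>

lemma interval_qm_nonneg_on_interval:
  assumes "a < b" "\<And>t. t \<in> {a..b} \<Longrightarrow> poly p t \<ge> 0"
  shows "poly p \<in> interval_quadratic_module a b"
  using assms(2)
proof (induction "degree p" arbitrary: p rule: less_induct)
  case less
  show ?case
  proof (cases "degree p = 0")
    case True
    then obtain c where c: "p = [:c:]" by (rule degree_eq_zeroE)
    then have "c \<ge> 0" using less.prems[of a] assms(1) by simp
    then have "(\<lambda>t. c) \<in> interval_quadratic_module a b" by (rule interval_qm_const)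
    moreover have "poly p = (\<lambda>t. c)" by (auto simp: c)
    ultimately show ?thesis by simp
  next
    case False
    have "\<exists>r\<in>{a..b}. \<forall>x\<in>{a..b}. poly p r \<le> poly p x"
      using assms(1) by (intro continuous_attains_inf) (auto intro!: continuous_intros)
    then obtain r where r: "r \<in> {a..b}" "\<And>x. x \<in> {a..b} \<Longrightarrow> poly p r \<le> poly p x"
      by blast
    have step: "poly p \<in> interval_quadratic_module a b"
      if s: "\<And>t. poly p t = poly p r + h t * poly s t" and deg: "degree s < degree p"
        and h: "h \<in> interval_quadratic_module a b" "\<And>t. t \<in> {a..b} \<Longrightarrow> t \<noteq> r \<Longrightarrow> h t > 0" for h s
    proof -
      have away: "poly s x \<ge> 0" if "x \<in> {a..b}" "x \<noteq> r" for x
        using r(2)[of x] s[of x] h(2)[of x] that by (auto simp: zero_le_mult_iff)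
      then have "poly s x \<ge> 0" if "x \<in> {a..b}" for x
        using poly_nonneg_at_excluded_point[OF assms(1) r(1)] that by blast
      then have "poly s \<in> interval_quadratic_module a b"
        using less.hyps deg by blast
      then have "(\<lambda>t. poly p r + h t * poly s t) \<in> interval_quadratic_module a b"
        using h(1) less.prems r(1) by (intro interval_qm_add interval_qm_const interval_qm_mult) auto
      then show ?thesis by (simp flip: s)
    qed
    consider "r = a" | "r = b" | "a < r" "r < b" using r(1) by force
    then show ?thesis
    proof cases
      case 1
      have "poly p t = poly p r + (t - a) * poly (synthetic_div p r) t" for t
        unfolding 1 by (rule poly_synthetic_div)
      then show ?thesis
      proof (rule step)
        show "degree (synthetic_div p r) < degree p" using False by (simp add: degree_synthetic_div)
        show "(\<lambda>t. t - a) \<in> interval_quadratic_module a b"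
          by (rule interval_qm_endpoint_factors(1)[OF assms(1)])
      qed (use 1 in auto)
    next
      case 2
      have "poly p t = poly p r + (b - t) * poly (- synthetic_div p r) t" for t
        using poly_synthetic_div[of p t r] unfolding 2 by (simp add: algebra_simps)
      then show ?thesis
      proof (rule step)
        show "degree (- synthetic_div p r) < degree p" using False by (simp add: degree_synthetic_div)
        show "(\<lambda>t. b - t) \<in> interval_quadratic_module a b"
          by (rule interval_qm_endpoint_factors(2)[OF assms(1)])
      qed (use 2 in auto)
    next
      case 3
      have local_min: "poly p r \<le> poly p x" if "\<bar>r - x\<bar> < min (r - a) (b - r)" for x
        using that by (intro r(2)) auto
      obtain s where s: "\<And>x. poly p x = poly p r + (x - r)\<^sup>2 * poly s x" "degree s = degree p - 2"
        using poly_minimum_factor[OF _ local_min] 3 by (metis diff_gt_0_iff_gt min_less_iff_conj)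
      show ?thesis
      proof (rule step[OF s(1)])
        show "degree s < degree p" using s(2) False by simp
        have "poly ([:-r, 1:]\<^sup>2) t \<ge> 0" for t by (simp add: poly_power)
        then have "poly ([:-r, 1:]\<^sup>2) \<in> interval_quadratic_module a b" by (rule interval_qm_nonneg_poly)
        moreover have "poly ([:-r, 1:]\<^sup>2) = (\<lambda>t. (t - r)\<^sup>2)" by (auto simp: poly_power)
        ultimately show "(\<lambda>t. (t - r)\<^sup>2) \<in> interval_quadratic_module a b" by simp
      qed simp
    qed
  qed
qed

section \<open>Approximate partitions of unity with monotone tail sums\<close>

lemma poly_antiderivative_exists:
  fixes p :: "'a::field_char_0 poly"
  obtains P where "pderiv P = p"
proof
  have "pderiv (\<Sum>i\<le>degree p. monom (coeff p i / of_nat (Suc i)) (Suc i)) = (\<Sum>i\<le>degree p. monom (coeff p i) i)"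
    unfolding higher_pderiv_sum[of 1, simplified] by (intro sum.cong refl) (simp add: pderiv_monom del: of_nat_Suc)
  then show "pderiv (\<Sum>i\<le>degree p. monom (coeff p i / of_nat (Suc i)) (Suc i)) = p"
    by (simp add: poly_as_sum_of_monoms)
qed

lemma DERIV_compare_increments:
  fixes A B :: "real \<Rightarrow> real"
  assumes "x \<le> y"
    and "\<And>u. (A has_real_derivative A' u) (at u)" "\<And>u. (B has_real_derivative B' u) (at u)"
    and "\<And>u. x \<le> u \<Longrightarrow> u \<le> y \<Longrightarrow> A' u \<le> B' u"
  shows "A y - A x \<le> B y - B x"
proof -
  have "B x - A x \<le> B y - A y"
  proof (rule DERIV_nonneg_imp_nondecreasing[OF assms(1)])
    fix u assume "x \<le> u" "u \<le> y"
    then show "\<exists>z. ((\<lambda>u. B u - A u) has_real_derivative z) (at u) \<and> 0 \<le> z"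
      using assms by (intro exI[of _ "B' u - A' u"]) (auto intro!: derivative_intros)
  qed
  then show ?thesis by simp
qed

text \<open>
The polynomial \<open>\<Phi>\<close> is the normalized antiderivative of the Landau kernel \<open>(1 - u\<^sup>2)^n\<close>; it climbs
from 0 to 1 on \<open>[-1, 1]\<close>, almost all of it near 0. The function \<open>\<Psi>\<close> is the antiderivative of the
kernel times \<open>u\<^sup>2\<close>, so its increment over \<open>[-1, 1]\<close> is the second moment. The moment is small
since the derivative of \<open>u (1 - u\<^sup>2)^(n+1)\<close> is \<open>(1 - u\<^sup>2)^n (1 - (2 n + 3) u\<^sup>2)\<close>, and
\<open>u (1 - u\<^sup>2)^(n+1)\<close> vanishes at both ends: it equals \<open>1 / (2 n + 3)\<close>. An even \<open>n\<close> makes the kernel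
nonnegative on the whole line.
\<close>

lemma landau_step:
  assumes "\<epsilon> > 0"
  obtains \<Phi> :: "real poly" and \<Psi> :: "real \<Rightarrow> real" and c n where
    "poly \<Phi> (-1) = 0" "poly \<Phi> 1 = 1" "c > 0" "even n"
    "\<And>u. poly (pderiv \<Phi>) u = c * (1 - u\<^sup>2) ^ n"
    "\<And>u. (\<Psi> has_real_derivative u\<^sup>2 * (c * (1 - u\<^sup>2) ^ n)) (at u)"
    "\<Psi> 1 - \<Psi> (-1) \<le> \<epsilon>"
proof -
  obtain m :: nat where m: "inverse (real (Suc m)) < \<epsilon>"
    using reals_Archimedean[OF assms] by blast
  define n where "n = 2 * m"
  obtain P :: "real poly" where P: "pderiv P = [:1, 0, -1:] ^ n"
    using poly_antiderivative_exists by blast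
  have P': "poly (pderiv P) u = (1 - u\<^sup>2) ^ n" for u
    by (simp add: P poly_power power2_eq_square)
  define I where "I = poly P 1 - poly P (-1)"
  have "I > 0"
  proof -
    have "\<exists>x. -1 < x \<and> x < 1 \<and> poly P 1 - poly P (-1) = (1 - (-1)) * poly (pderiv P) x"
      by (rule MVT2) auto
    then obtain x :: real where "-1 < x" "x < 1" "I = 2 * (1 - x\<^sup>2) ^ n" by (auto simp: I_def P')
    moreover from this have "x\<^sup>2 < 1" by (simp add: abs_square_less_1)
    ultimately show ?thesis by (auto intro!: zero_less_power)
  qed
  define \<Phi> where "\<Phi> = smult (1 / I) (P - [:poly P (-1):])"
  define \<Psi> where "\<Psi> u = (poly \<Phi> u - 1 / I * (u * (1 - u\<^sup>2) ^ Suc n)) / (2 * n + 3)" for u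
  have d\<Phi>: "poly (pderiv \<Phi>) u = 1 / I * (1 - u\<^sup>2) ^ n" for u
    by (simp add: \<Phi>_def pderiv_smult pderiv_diff P' pderiv_pCons)
  have ends: "poly \<Phi> (-1) = 0" "poly \<Phi> 1 = 1"
    using \<open>I > 0\<close> by (simp_all add: \<Phi>_def I_def)
  show ?thesis
  proof (rule that[of \<Phi> "1 / I" n \<Psi>])
    show "(\<Psi> has_real_derivative u\<^sup>2 * (1 / I * (1 - u\<^sup>2) ^ n)) (at u)" for u
    proof -
      have "(\<Psi> has_real_derivative (1 / I * (1 - u\<^sup>2) ^ n
          - 1 / I * ((1 - u\<^sup>2) ^ Suc n + u * (real (Suc n) * (1 - u\<^sup>2) ^ n * (- 2 * u)))) / (2 * n + 3)) (at u)"
        unfolding \<Psi>_def using \<open>I > 0\<close>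
        by (auto intro!: derivative_eq_intros poly_DERIV simp: d\<Phi> simp del: power_Suc of_nat_Suc)
      also have "(1 / I * (1 - u\<^sup>2) ^ n
          - 1 / I * ((1 - u\<^sup>2) ^ Suc n + u * (real (Suc n) * (1 - u\<^sup>2) ^ n * (- 2 * u)))) / (2 * n + 3)
        = u\<^sup>2 * (1 / I * (1 - u\<^sup>2) ^ n)"
        using \<open>I > 0\<close> by (simp add: divide_simps) (simp add: algebra_simps power2_eq_square)
      finally show ?thesis .
    qed
    have "\<Psi> 1 - \<Psi> (-1) = 1 / (2 * real n + 3)"
      by (simp add: \<Psi>_def ends)
    also have "\<dots> \<le> inverse (real (Suc m))"
      by (simp add: n_def divide_simps)
    finally show "\<Psi> 1 - \<Psi> (-1) \<le> \<epsilon>" using m by simp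
    show "1 / I > 0" using \<open>I > 0\<close> by simp
  qed (use ends d\<Phi> in \<open>auto simp: n_def\<close>)
qed

text \<open>
The weights are the increments \<open>\<Phi> (t - \<tau> k) - \<Phi> (t - \<tau> (k + 1))\<close> over a fine grid; they are
nonnegative everywhere because \<open>\<Phi>\<close> is increasing. A tail sum telescopes, and its derivative is
\<open>K (t - \<tau> k) - K (t - 1)\<close> for the kernel \<open>K\<close>, the last grid point being 1. The sizes of the grid
\<open>[-1/3, 1]\<close> and of the target interval \<open>[0, 1/3]\<close> are chosen for this: \<open>t\<close> is never farther
from \<open>\<tau> k\<close> than from 1, so the derivative is nonnegative, while the grid still extends at least \<open>1/3\<close>
beyond the target on both sides, which lets the weights capture almost the full mass. Grid points
outside the target are clamped to it, which only brings them closer to \<open>t\<close>.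
\<close>

lemma quasi_partition_unit:
  assumes "\<eta> > 0"
  shows "\<exists>(N :: nat) (y :: nat \<Rightarrow> real) (w :: nat \<Rightarrow> real poly).
    (\<forall>k. y k \<in> {0..1/3}) \<and> (\<forall>k l. k \<le> l \<longrightarrow> y k \<le> y l) \<and> (\<forall>k t. poly (w k) t \<ge> 0) \<and>
    (\<forall>k<N. \<forall>t\<in>{0..1/3}. (\<Sum>l=k..<N. poly (pderiv (w l)) t) \<ge> 0) \<and>
    (\<forall>t\<in>{0..1/3}. (\<Sum>k<N. poly (w k) t) \<in> {1 - \<eta>..1} \<and>
                (\<Sum>k<N. poly (w k) t * (y k - t)\<^sup>2) \<le> \<eta>)"
proof -
  obtain \<Phi> \<Psi> c n where \<Phi>: "poly \<Phi> (-1) = 0" "poly \<Phi> 1 = 1" "c > 0" "even n"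
    and d\<Phi>: "\<And>u. poly (pderiv \<Phi>) u = c * (1 - u\<^sup>2) ^ n"
    and d\<Psi>: "\<And>u. (\<Psi> has_real_derivative u\<^sup>2 * (c * (1 - u\<^sup>2) ^ n)) (at u)"
    and small: "\<Psi> 1 - \<Psi> (-1) \<le> \<eta> / 9"
    using landau_step[of "\<eta> / 9"] assms by (metis divide_pos_pos zero_less_numeral)
  define K where "K u = c * (1 - u\<^sup>2) ^ n" for u
  have D\<Phi>: "(poly \<Phi> has_real_derivative K u) (at u)" for u
    using poly_DERIV[of \<Phi> u] by (simp add: d\<Phi> K_def)
  have D\<Psi>: "(\<Psi> has_real_derivative u\<^sup>2 * K u) (at u)" for u
    using d\<Psi>[of u] by (simp add: K_def)
  have K_nonneg: "K u \<ge> 0" for u using \<Phi>(3,4) by (simp add: K_def zero_le_even_power)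
  have \<Phi>_mono: "poly \<Phi> u \<le> poly \<Phi> v" if "u \<le> v" for u v
    using DERIV_compare_increments[OF that, of "\<lambda>_. 0" "\<lambda>_. 0" "poly \<Phi>" K] D\<Phi> K_nonneg by simp
  have \<Psi>_mono: "\<Psi> u \<le> \<Psi> v" if "u \<le> v" for u v
    using DERIV_compare_increments[OF that, of "\<lambda>_. 0" "\<lambda>_. 0" \<Psi> "\<lambda>u. u\<^sup>2 * K u"] D\<Psi> K_nonneg by simp
  obtain M :: nat where M: "inverse (real (Suc M)) < sqrt \<eta> / 4"
    using reals_Archimedean[of "sqrt \<eta> / 4"] assms by auto
  define N where "N = Suc M"
  define h where "h = 4 / (3 * real N)"
  have "h > 0" by (simp add: h_def N_def)
  have h2: "h\<^sup>2 \<le> \<eta> / 9"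
  proof -
    have "h = 4 / 3 * inverse (real (Suc M))" unfolding h_def N_def by (simp add: field_simps)
    also have "\<dots> \<le> 4 / 3 * (sqrt \<eta> / 4)" using M by (intro mult_left_mono) auto
    finally have "h \<le> sqrt \<eta> / 3" by simp
    then have "h\<^sup>2 \<le> (sqrt \<eta> / 3)\<^sup>2" using \<open>h > 0\<close> by (intro power_mono) auto
    then show ?thesis using assms by (simp add: power_divide)
  qed
  define \<tau> where "\<tau> k = - (1/3) + real k * h" for k
  have \<tau>0: "\<tau> 0 = -1/3" by (simp add: \<tau>_def)
  have "real N * h = 4 / 3" by (simp add: h_def N_def del: of_nat_Suc)
  then have \<tau>N: "\<tau> N = 1" by (simp add: \<tau>_def)
  have \<tau>_mono: "\<tau> k \<le> \<tau> l" if "k \<le> l" for k l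
    using that \<open>h > 0\<close> by (simp add: \<tau>_def)
  define w where "w k = pcompose \<Phi> [:- \<tau> k, 1:] - pcompose \<Phi> [:- \<tau> (Suc k), 1:]" for k
  define y where "y k = max 0 (min (1/3) (\<tau> k))" for k
  have w: "poly (w k) t = poly \<Phi> (t - \<tau> k) - poly \<Phi> (t - \<tau> (Suc k))" for k t
    by (simp add: w_def poly_pcompose)
  have dw: "poly (pderiv (w k)) t = K (t - \<tau> k) - K (t - \<tau> (Suc k))" for k t
    by (simp add: w_def pderiv_diff pderiv_pcompose poly_pcompose d\<Phi> K_def pderiv_pCons)
  have S: "(\<Sum>k<N. poly (w k) t) = poly \<Phi> (t + 1/3) - poly \<Phi> (t - 1)" for t
    using sum_lessThan_telescope'[of "\<lambda>k. poly \<Phi> (t - \<tau> k)" N] by (simp add: w \<tau>0 \<tau>N)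
  have S_le: "(\<Sum>k<N. poly (w k) t) \<le> 1" if "t \<in> {0..1/3}" for t
    using that \<Phi>_mono[of "t + 1/3" 1] \<Phi>_mono[of "-1" "t - 1"] \<Phi>(1,2) by (simp add: S)
  show ?thesis
  proof (intro exI[of _ N] exI[of _ y] exI[of _ w] conjI allI impI ballI)
    show "y k \<in> {0..1/3}" for k by (auto simp: y_def)
    show "y k \<le> y l" if "k \<le> l" for k l using \<tau>_mono[OF that] by (auto simp: y_def)
    show "poly (w k) t \<ge> 0" for k t
      using \<Phi>_mono[of "t - \<tau> (Suc k)" "t - \<tau> k"] \<tau>_mono[of k "Suc k"] by (simp add: w)
    show "(\<Sum>l=k..<N. poly (pderiv (w l)) t) \<ge> 0" if "k < N" "t \<in> {0..1/3}" for k t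
    proof -
      have "(\<Sum>l=k..<N. poly (pderiv (w l)) t) = - (\<Sum>l=k..<N. K (t - \<tau> (Suc l)) - K (t - \<tau> l))"
        by (simp add: dw flip: sum_negf)
      also have "\<dots> = K (t - \<tau> k) - K (t - 1)"
        using sum_Suc_diff'[of k N "\<lambda>l. K (t - \<tau> l)"] that(1) by (simp add: \<tau>N)
      also have "\<dots> \<ge> 0"
      proof -
        have "-1/3 \<le> \<tau> k" "\<tau> k \<le> 1" using \<tau>_mono[of 0 k] \<tau>_mono[of k N] that(1) \<tau>0 \<tau>N by auto
        then have "\<bar>t - \<tau> k\<bar> \<le> \<bar>t - 1\<bar>" "\<bar>t - 1\<bar> \<le> 1" using that(2) by auto
        then have "(t - \<tau> k)\<^sup>2 \<le> (t - 1)\<^sup>2" "(t - 1)\<^sup>2 \<le> 1"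
          by (simp_all only: abs_le_square_iff abs_square_le_1)
        then show ?thesis using \<Phi>(3) by (auto simp: K_def intro!: power_mono mult_left_mono)
      qed
      finally show ?thesis .
    qed
    show "(\<Sum>k<N. poly (w k) t) \<in> {1 - \<eta>..1}" if t: "t \<in> {0..1/3}" for t
    proof -
      \<comment> \<open>Chebyshev: the mass that the grid misses lies at distance at least 1/3 from the centre.\<close>
      have far: "K u \<le> 9 * (u\<^sup>2 * K u)" if "\<bar>u\<bar> \<ge> 1/3" for u
      proof -
        have "(1/3)\<^sup>2 \<le> u\<^sup>2" using that abs_le_square_iff[of "1/3" u] by simp
        then have "1 * K u \<le> (9 * u\<^sup>2) * K u"
          using K_nonneg[of u] by (intro mult_right_mono) (auto simp: power2_eq_square)
        then show ?thesis by simp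
      qed
      have D9: "((\<lambda>u. 9 * \<Psi> u) has_real_derivative 9 * (u\<^sup>2 * K u)) (at u)" for u
        by (intro DERIV_cmult D\<Psi>)
      have "poly \<Phi> 1 - poly \<Phi> (t + 1/3) \<le> 9 * \<Psi> 1 - 9 * \<Psi> (t + 1/3)"
        using t by (intro DERIV_compare_increments[OF _ D\<Phi> D9] far) auto
      moreover have "poly \<Phi> (t - 1) - poly \<Phi> (-1) \<le> 9 * \<Psi> (t - 1) - 9 * \<Psi> (-1)"
        using t by (intro DERIV_compare_increments[OF _ D\<Phi> D9] far) auto
      moreover have "\<Psi> (t - 1) \<le> \<Psi> (t + 1/3)" by (rule \<Psi>_mono) simp
      ultimately show ?thesis using S[of t] S_le[OF t] small \<Phi>(1,2) by simp
    qed
    show "(\<Sum>k<N. poly (w k) t * (y k - t)\<^sup>2) \<le> \<eta>" if t: "t \<in> {0..1/3}" for t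
    proof -
      have "poly (w k) t * (y k - t)\<^sup>2
          \<le> 2 * (\<Psi> (t - \<tau> k) - \<Psi> (t - \<tau> (Suc k))) + 2 * h\<^sup>2 * poly (w k) t" if "k < N" for k
      proof -
        define a where "a = t - \<tau> k"
        have b: "t - \<tau> (Suc k) = a - h" by (simp add: a_def \<tau>_def algebra_simps)
        have "\<bar>y k - t\<bar> \<le> \<bar>a\<bar>" using t by (auto simp: a_def y_def)
        then have "(y k - t)\<^sup>2 \<le> a\<^sup>2" by (simp only: abs_le_square_iff)
        moreover have "poly (w k) t \<ge> 0"
          using \<Phi>_mono[of "a - h" a] \<open>h > 0\<close> by (simp add: w b flip: a_def)
        ultimately have "poly (w k) t * (y k - t)\<^sup>2 \<le> a\<^sup>2 * poly (w k) t"
          by (simp add: mult.commute mult_left_mono)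
        also have "\<dots> = a\<^sup>2 * poly \<Phi> a - a\<^sup>2 * poly \<Phi> (a - h)"
          by (simp add: w b right_diff_distrib flip: a_def)
        \<comment> \<open>Integrated form of the pointwise bound \<open>a\<^sup>2 \<le> 2 u\<^sup>2 + 2 h\<^sup>2\<close> for \<open>u\<close> between \<open>a - h\<close> and \<open>a\<close>.\<close>
        also have "\<dots> \<le> (2 * \<Psi> a + 2 * h\<^sup>2 * poly \<Phi> a) - (2 * \<Psi> (a - h) + 2 * h\<^sup>2 * poly \<Phi> (a - h))"
        proof (rule DERIV_compare_increments)
          show "((\<lambda>u. a\<^sup>2 * poly \<Phi> u) has_real_derivative a\<^sup>2 * K u) (at u)" for u
            by (intro DERIV_cmult D\<Phi>)
          show "((\<lambda>u. 2 * \<Psi> u + 2 * h\<^sup>2 * poly \<Phi> u) has_real_derivative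
                  2 * (u\<^sup>2 * K u) + 2 * h\<^sup>2 * K u) (at u)" for u
            by (intro DERIV_add DERIV_cmult D\<Phi> D\<Psi>)
          fix u assume u: "a - h \<le> u" "u \<le> a"
          have "(a - u)\<^sup>2 \<le> h\<^sup>2" using u by (intro power_mono) auto
          moreover have "a\<^sup>2 + (2 * u - a)\<^sup>2 = 2 * u\<^sup>2 + 2 * (a - u)\<^sup>2"
            by (simp add: power2_eq_square algebra_simps)
          ultimately have "a\<^sup>2 \<le> 2 * u\<^sup>2 + 2 * h\<^sup>2"
            using zero_le_power2[of "2 * u - a"] by linarith
          from mult_right_mono[OF this K_nonneg[of u]]
          show "a\<^sup>2 * K u \<le> 2 * (u\<^sup>2 * K u) + 2 * h\<^sup>2 * K u" by (simp add: algebra_simps)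
        qed (use \<open>h > 0\<close> in auto)
        finally show ?thesis by (simp add: w b right_diff_distrib flip: a_def)
      qed
      then have "(\<Sum>k<N. poly (w k) t * (y k - t)\<^sup>2)
          \<le> (\<Sum>k<N. 2 * (\<Psi> (t - \<tau> k) - \<Psi> (t - \<tau> (Suc k))) + 2 * h\<^sup>2 * poly (w k) t)"
        by (intro sum_mono) auto
      also have "\<dots> = 2 * (\<Psi> (t + 1/3) - \<Psi> (t - 1)) + 2 * h\<^sup>2 * (\<Sum>k<N. poly (w k) t)"
        unfolding sum.distrib sum_distrib_left[symmetric]
          sum_lessThan_telescope'[of "\<lambda>k. \<Psi> (t - \<tau> k)"]
        by (simp add: \<tau>0 \<tau>N)
      also have "\<dots> \<le> 2 * (\<eta> / 9) + 2 * (\<eta> / 9) * 1"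
      proof (intro add_mono mult_mono)
        show "\<Psi> (t + 1/3) - \<Psi> (t - 1) \<le> \<eta> / 9"
          using t \<Psi>_mono[of "t + 1/3" 1] \<Psi>_mono[of "-1" "t - 1"] small by simp
        show "0 \<le> (\<Sum>k<N. poly (w k) t)"
          using \<Phi>_mono[of "t - 1" "t + 1/3"] by (simp add: S)
        show "0 \<le> \<Psi> (t + 1/3) - \<Psi> (t - 1)" using \<Psi>_mono[of "t - 1" "t + 1/3"] by simp
      qed (use h2 S_le[OF t] assms in auto)
      finally show ?thesis using assms by simp
    qed
  qed
qed

text \<open>
Nodes \<open>y k\<close> with polynomial weights \<open>w k\<close> on \<open>[a, b]\<close>, oriented by the sign \<open>s\<close>: the nodes
ascend for \<open>s = 1\<close> and descend for \<open>s = -1\<close>. The tail sums of the weights are monotone in the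
direction of \<open>s\<close>, with a certificate. The weights add up to 1 only approximately: nonnegative
polynomials on the line whose sum is exactly 1 are bounded and hence constant. The last
condition says that the weights at \<open>t\<close> concentrate on nodes near \<open>t\<close>.
\<close>

definition monotone_quasi_partition ::
    "real \<Rightarrow> real \<Rightarrow> real \<Rightarrow> real \<Rightarrow> nat \<Rightarrow> (nat \<Rightarrow> real) \<Rightarrow> (nat \<Rightarrow> real poly) \<Rightarrow> bool" where
  "monotone_quasi_partition s a b \<eta> N y w \<longleftrightarrow>
     (\<forall>k<N. y k \<in> {a..b}) \<and> (\<forall>l<N. \<forall>k\<le>l. s * y k \<le> s * y l) \<and>
     (\<forall>k<N. \<forall>t. poly (w k) t \<ge> 0) \<and>
     (\<forall>k<N. (\<lambda>t. s * (\<Sum>l=k..<N. poly (pderiv (w l)) t)) \<in> interval_quadratic_module a b) \<and>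
     (\<forall>t\<in>{a..b}. (\<Sum>k<N. poly (w k) t) \<in> {1 - \<eta>..1} \<and> (\<Sum>k<N. poly (w k) t * (y k - t)\<^sup>2) \<le> \<eta>)"

text \<open>
Transport from \<open>[0, 1/3]\<close> along an affine map. A decreasing map yields the orientation \<open>s = -1\<close>,
so both signs are treated at once; second moments scale by \<open>(3 (b - a))\<^sup>2\<close>.
\<close>

lemma monotone_quasi_partition_affine:
  assumes "a < b" "\<eta> > 0" "s * \<mu> = 1 / (3 * (b - a))" and s: "s * s = 1"
    and maps: "\<And>t. t \<in> {a..b} \<longleftrightarrow> m + \<mu> * t \<in> {0..1/3}"
  shows "\<exists>N y w. monotone_quasi_partition s a b \<eta> N y w"
proof -
  define C where "C = (3 * (b - a))\<^sup>2"
  have "C > 0" using \<open>a < b\<close> by (simp add: C_def)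
  have \<mu>0: "\<mu> \<noteq> 0" using assms(1,3) by auto
  have \<mu>2: "\<mu>\<^sup>2 = 1 / C"
  proof -
    have "\<mu>\<^sup>2 = (s * \<mu>)\<^sup>2" using s by (simp add: power2_eq_square algebra_simps)
    then show ?thesis by (simp add: assms(3) C_def power_divide)
  qed
  have s\<mu>: "s * \<mu> > 0" using assms(1,3) by simp
  define \<delta> where "\<delta> = min \<eta> (\<eta> / C)"
  have "\<delta> > 0" using \<open>C > 0\<close> \<open>\<eta> > 0\<close> by (simp add: \<delta>_def)
  from quasi_partition_unit[OF this] obtain N :: nat and y :: "nat \<Rightarrow> real" and w :: "nat \<Rightarrow> real poly" where
    y: "\<forall>k. y k \<in> {0..1/3}" "\<forall>k l. k \<le> l \<longrightarrow> y k \<le> y l" and w: "\<forall>k t. poly (w k) t \<ge> 0"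
    and tail: "\<forall>k<N. \<forall>t\<in>{0..1/3}. (\<Sum>l=k..<N. poly (pderiv (w l)) t) \<ge> 0"
    and sums: "\<forall>t\<in>{0..1/3}. (\<Sum>k<N. poly (w k) t) \<in> {1 - \<delta>..1} \<and>
                (\<Sum>k<N. poly (w k) t * (y k - t)\<^sup>2) \<le> \<delta>"
    by (elim exE conjE) (rule that)
  define y' where "y' k = (y k - m) / \<mu>" for k
  define w' where "w' k = pcompose (w k) [:m, \<mu>:]" for k
  have w': "poly (w' k) t = poly (w k) (m + \<mu> * t)" for k t
    by (simp add: w'_def poly_pcompose algebra_simps)
  have y': "m + \<mu> * y' k = y k" for k using \<mu>0 by (simp add: y'_def)
  have "monotone_quasi_partition s a b \<eta> N y' w'"
    unfolding monotone_quasi_partition_def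
  proof (intro conjI allI impI ballI)
    show "y' k \<in> {a..b}" for k using spec[OF y(1), of k] maps[of "y' k"] by (simp add: y')
    show "s * y' k \<le> s * y' l" if "k \<le> l" for k l
    proof -
      have "s * \<mu> * (s * y' k) = s * s * (\<mu> * y' k)" for k by (simp only: mult_ac)
      then have "s * \<mu> * (s * y' k) = y k - m" for k
        unfolding s mult_1 y'[symmetric, of k] by simp
      then have "s * \<mu> * (s * y' k) \<le> s * \<mu> * (s * y' l)" using y(2) that by simp
      then show ?thesis using s\<mu> by (simp only: mult_le_cancel_left_pos)
    qed
    show "0 \<le> poly (w' k) t" for k t by (simp add: w' w)
    show "(\<lambda>t. s * (\<Sum>l=k..<N. poly (pderiv (w' l)) t)) \<in> interval_quadratic_module a b" if "k < N" for k
    proof -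
      define q where "q = smult s (\<Sum>l=k..<N. pderiv (w' l))"
      have dw': "poly (pderiv (w' l)) t = \<mu> * poly (pderiv (w l)) (m + \<mu> * t)" for l t
        by (simp add: w'_def pderiv_pcompose poly_pcompose pderiv_pCons algebra_simps)
      have "poly q t = s * \<mu> * (\<Sum>l=k..<N. poly (pderiv (w l)) (m + \<mu> * t))" for t
        by (simp add: q_def poly_sum dw' mult.assoc flip: sum_distrib_left)
      then have "poly q t \<ge> 0" if "t \<in> {a..b}" for t
        using tail \<open>k < N\<close> maps[of t] that s\<mu> by simp
      then have "poly q \<in> interval_quadratic_module a b"
        by (rule interval_qm_nonneg_on_interval[OF assms(1)])
      moreover have "poly q = (\<lambda>t. s * (\<Sum>l=k..<N. poly (pderiv (w' l)) t))"
        by (auto simp: q_def poly_sum)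
      ultimately show ?thesis by simp
    qed
    fix t assume t: "t \<in> {a..b}"
    then have t': "m + \<mu> * t \<in> {0..1/3}" using maps by blast
    show "(\<Sum>k<N. poly (w' k) t) \<in> {1 - \<eta>..1}"
      using bspec[OF sums t'] by (auto simp: w' \<delta>_def)
    have "(\<Sum>k<N. poly (w' k) t * (y' k - t)\<^sup>2) = C * (\<Sum>k<N. poly (w k) (m + \<mu> * t) * (y k - (m + \<mu> * t))\<^sup>2)"
    proof -
      have "C * (y k - (m + \<mu> * t))\<^sup>2 = (y' k - t)\<^sup>2" for k
      proof -
        have "y k - (m + \<mu> * t) = \<mu> * (y' k - t)" using y'[of k] by (simp add: algebra_simps)
        then show ?thesis using \<mu>2 \<open>C > 0\<close> by (simp add: power_mult_distrib)
      qed
      then show ?thesis by (simp add: w' sum_distrib_left mult.left_commute[of C])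
    qed
    also have "\<dots> \<le> C * (\<eta> / C)"
      using bspec[OF sums t'] \<open>C > 0\<close> by (intro mult_left_mono) (auto simp: \<delta>_def)
    finally show "(\<Sum>k<N. poly (w' k) t * (y' k - t)\<^sup>2) \<le> \<eta>" using \<open>C > 0\<close> by simp
  qed
  then show ?thesis by blast
qed

text \<open>
On a degenerate interval a single node with constant weight 1 is used. The approximant then does not
depend on that coordinate, so that its derivative there is zero, which is trivially certified.
\<close>

lemma monotone_quasi_partition_exists:
  assumes "a \<le> b" "\<eta> > 0" "s = 1 \<or> s = -1"
  shows "\<exists>N y w. monotone_quasi_partition s a b \<eta> N y w"
proof (cases "a = b")
  case True
  have "monotone_quasi_partition s a b \<eta> 1 (\<lambda>_. a) (\<lambda>_. 1)"
    using assms True interval_qm_const[of 0] by (auto simp: monotone_quasi_partition_def)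
  then show ?thesis by blast
next
  case False
  then have "a < b" using assms(1) by simp
  have scale: "x / (3 * D) \<in> {0..1/3} \<longleftrightarrow> x \<in> {0..D}" if "D > 0" for x D :: real
    using that by (auto simp: divide_simps)
  from assms(3) show ?thesis
  proof
    assume "s = 1"
    show ?thesis
    proof (rule monotone_quasi_partition_affine[OF \<open>a < b\<close> \<open>\<eta> > 0\<close>])
      show "s * (1 / (3 * (b - a))) = 1 / (3 * (b - a))" "s * s = 1" using \<open>s = 1\<close> by auto
      have "- a / (3 * (b - a)) + 1 / (3 * (b - a)) * t = (t - a) / (3 * (b - a))" for t
        by (simp add: diff_divide_distrib)
      then show "t \<in> {a..b} \<longleftrightarrow> - a / (3 * (b - a)) + 1 / (3 * (b - a)) * t \<in> {0..1/3}" for t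
        using \<open>a < b\<close> by (simp only: scale diff_gt_0_iff_gt) auto
    qed
  next
    assume "s = -1"
    show ?thesis
    proof (rule monotone_quasi_partition_affine[OF \<open>a < b\<close> \<open>\<eta> > 0\<close>])
      show "s * (- 1 / (3 * (b - a))) = 1 / (3 * (b - a))" "s * s = 1" using \<open>s = -1\<close> by auto
      have "b / (3 * (b - a)) + - 1 / (3 * (b - a)) * t = (b - t) / (3 * (b - a))" for t
        by (simp add: diff_divide_distrib)
      then show "t \<in> {a..b} \<longleftrightarrow> b / (3 * (b - a)) + - 1 / (3 * (b - a)) * t \<in> {0..1/3}" for t
        using \<open>a < b\<close> by (simp only: scale diff_gt_0_iff_gt) auto
    qed
  qed
qed

section \<open>Monomial expansions\<close>

text \<open>
Unlike \<^const>\<open>has_total_degree\<close>, zero coefficients are allowed, so that this class is closed under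
addition and multiplication without any cancellation being tracked.
\<close>

definition monomial_sum :: "(real ^ 'n \<Rightarrow> real) \<Rightarrow> bool" where
  "monomial_sum p \<longleftrightarrow> (\<exists>(A :: ('n \<Rightarrow> nat) set) c. finite A \<and>
     (\<forall>x. p x = (\<Sum>\<alpha>\<in>A. c \<alpha> * (\<Prod>i\<in>UNIV. x $ i ^ \<alpha> i))))"

lemma monomial_sum_add:
  assumes "monomial_sum p" "monomial_sum q"
  shows "monomial_sum (\<lambda>x. p x + q x)"
proof -
  obtain A c where A: "finite A" "\<And>x. p x = (\<Sum>\<alpha>\<in>A. c \<alpha> * (\<Prod>i\<in>UNIV. x $ i ^ \<alpha> i))"
    using assms(1) unfolding monomial_sum_def by blast
  obtain B d where B: "finite B" "\<And>x. q x = (\<Sum>\<alpha>\<in>B. d \<alpha> * (\<Prod>i\<in>UNIV. x $ i ^ \<alpha> i))"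
    using assms(2) unfolding monomial_sum_def by blast
  let ?c = "\<lambda>\<alpha>. (if \<alpha> \<in> A then c \<alpha> else 0) + (if \<alpha> \<in> B then d \<alpha> else 0)"
  have "p x + q x = (\<Sum>\<alpha>\<in>A\<union>B. ?c \<alpha> * (\<Prod>i\<in>UNIV. x $ i ^ \<alpha> i))" for x
  proof -
    have "p x = (\<Sum>\<alpha>\<in>A\<union>B. (if \<alpha> \<in> A then c \<alpha> else 0) * (\<Prod>i\<in>UNIV. x $ i ^ \<alpha> i))"
      unfolding A(2) using A(1) B(1) by (intro sum.mono_neutral_cong_left) auto
    moreover have "q x = (\<Sum>\<alpha>\<in>A\<union>B. (if \<alpha> \<in> B then d \<alpha> else 0) * (\<Prod>i\<in>UNIV. x $ i ^ \<alpha> i))"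
      unfolding B(2) using A(1) B(1) by (intro sum.mono_neutral_cong_left) auto
    ultimately show ?thesis
      by (simp add: distrib_right sum.distrib)
  qed
  then show ?thesis unfolding monomial_sum_def using A(1) B(1)
    by (intro exI[of _ "A \<union> B"] exI[of _ ?c]) auto
qed

lemma monomial_sum_monomial: "monomial_sum (\<lambda>x. c * (\<Prod>i\<in>UNIV. x $ i ^ \<alpha> i))"
  unfolding monomial_sum_def by (intro exI[of _ "{\<alpha>}"] exI[of _ "\<lambda>_. c"]) auto

lemma monomial_sum_const: "monomial_sum (\<lambda>x. c)"
  using monomial_sum_monomial[of c "\<lambda>_. 0"] by simp

lemma monomial_sum_sum:
  "finite I \<Longrightarrow> (\<And>i. i \<in> I \<Longrightarrow> monomial_sum (p i)) \<Longrightarrow> monomial_sum (\<lambda>x. \<Sum>i\<in>I. p i x)"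
  by (induction I rule: finite_induct) (auto intro: monomial_sum_add monomial_sum_const)

lemma monomial_sum_mult:
  assumes "monomial_sum p" "monomial_sum q"
  shows "monomial_sum (\<lambda>x. p x * q x)"
proof -
  obtain A c where A: "finite A" "\<And>x. p x = (\<Sum>\<alpha>\<in>A. c \<alpha> * (\<Prod>i\<in>UNIV. x $ i ^ \<alpha> i))"
    using assms(1) unfolding monomial_sum_def by blast
  obtain B d where B: "finite B" "\<And>x. q x = (\<Sum>\<alpha>\<in>B. d \<alpha> * (\<Prod>i\<in>UNIV. x $ i ^ \<alpha> i))"
    using assms(2) unfolding monomial_sum_def by blast
  have "p x * q x = (\<Sum>\<alpha>\<in>A. \<Sum>\<beta>\<in>B. (c \<alpha> * d \<beta>) * (\<Prod>i\<in>UNIV. x $ i ^ (\<alpha> i + \<beta> i)))" for x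
    by (simp add: A(2) B(2) sum_product power_add prod.distrib mult_ac)
  then show ?thesis
    using A(1) B(1) by (simp add: monomial_sum_sum monomial_sum_monomial)
qed

lemma monomial_sum_real_polynomial_function:
  fixes p :: "real ^ 'n \<Rightarrow> real"
  assumes "real_polynomial_function p"
  shows "monomial_sum p"
  using assms
proof induction
  case (linear f)
  have "(\<Sum>i\<in>UNIV. f (axis i 1) * (\<Prod>j\<in>UNIV. x $ j ^ (if j = i then 1 else 0))) = f x" for x
  proof -
    have "(\<Prod>j\<in>UNIV. x $ j ^ (if j = i then 1 else 0)) = x $ i" for i
      by (simp add: if_distrib cong: if_cong)
    moreover have "f x = f (\<Sum>i\<in>UNIV. x $ i *\<^sub>R axis i 1)"
      using basis_expansion[of x] by (simp add: scalar_mult_eq_scaleR)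
    ultimately show ?thesis
      using linear by (simp add: bounded_linear.linear linear_sum linear_cmul mult.commute)
  qed
  then show ?case
    using monomial_sum_sum[of UNIV "\<lambda>i x. f (axis i 1) * (\<Prod>j\<in>UNIV. x $ j ^ (if j = i then 1 else 0))"]
    by (simp add: monomial_sum_monomial)
qed (auto intro: monomial_sum_add monomial_sum_mult monomial_sum_const)

lemma has_total_degree_exists:
  fixes p :: "real ^ 'n \<Rightarrow> real"
  assumes "real_polynomial_function p"
  shows "\<exists>d. has_total_degree p d"
proof -
  obtain A c where A: "finite A" "\<And>x. p x = (\<Sum>\<alpha>\<in>A. c \<alpha> * (\<Prod>i\<in>UNIV. x $ i ^ \<alpha> i))"
    using monomial_sum_real_polynomial_function[OF assms] unfolding monomial_sum_def by blast
  have "p x = (\<Sum>\<alpha>\<in>{\<alpha>\<in>A. c \<alpha> \<noteq> 0}. c \<alpha> * (\<Prod>i\<in>UNIV. x $ i ^ \<alpha> i))" for x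
    unfolding A(2) using A(1) by (intro sum.mono_neutral_right) auto
  then show ?thesis unfolding has_total_degree_def using A(1)
    by (intro exI[of _ "Max _"] exI[of _ "{\<alpha>\<in>A. c \<alpha> \<noteq> 0}"] exI[of _ c]) auto
qed

section \<open>Certificates imply monotonicity\<close>

lemma mem_constraint_box:
  assumes "\<And>i. bm $ i \<le> bp $ i"
  shows "u \<in> constraint_box bm bp \<longleftrightarrow> (\<forall>i. u $ i \<in> {bm $ i..bp $ i})"
proof -
  have "(bp $ i - u $ i) * (u $ i - bm $ i) \<ge> 0 \<longleftrightarrow> u $ i \<in> {bm $ i..bp $ i}" for i
    using assms[of i] by (auto simp: zero_le_mult_iff)
  then show ?thesis by (simp add: constraint_box_def)
qed

lemma DERIV_along_axis:
  fixes p :: "real ^ 'n \<Rightarrow> real"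
  assumes "real_polynomial_function p"
  shows "((\<lambda>t. p (x + t *\<^sub>R axis j 1)) has_real_derivative partial_derivative p j (x + t *\<^sub>R axis j 1)) (at t)"
proof -
  let ?y = "x + t *\<^sub>R axis j 1"
  have "p differentiable at ?y"
    using assms by (simp add: differentiable_at_polynomial_function real_polynomial_function_eq)
  then have "(p has_derivative frechet_derivative p (at ?y)) (at ?y)"
    by (simp add: frechet_derivative_works)
  moreover have "((\<lambda>t. x + t *\<^sub>R axis j 1) has_vector_derivative axis j 1) (at t)"
    by (auto intro!: derivative_eq_intros simp: has_vector_derivative_def)
  ultimately show ?thesis
    using vector_derivative_diff_chain_within[of "\<lambda>t. x + t *\<^sub>R axis j 1" "axis j 1" t UNIV p]
    by (simp add: has_real_derivative_iff_has_vector_derivative o_def partial_derivative_def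
        has_derivative_at_withinI)
qed

text \<open>
On the box each constraint product and each sum of squares is nonnegative, so the certified
derivative has the right sign, and monotonicity follows by integrating along coordinate segments,
which stay inside the box.
\<close>

lemma profile_of_certificate:
  fixes p :: "real ^ 'n \<Rightarrow> real"
  assumes bounds: "\<And>i. bm $ i \<le> bp $ i" and poly: "real_polynomial_function p"
    and cert: "has_sos_monotonicity_certificate bm bp \<rho> p"
  shows "has_monotonicity_profile (constraint_box bm bp) \<rho> p"
proof -
  let ?B = "constraint_box bm bp"
  have nonneg: "\<rho> $ j * partial_derivative p j z \<ge> 0" if "\<rho> $ j \<noteq> 0" "z \<in> ?B" for j z
  proof -
    obtain \<sigma>0 \<sigma> where s: "sum_of_squares \<sigma>0" "\<And>k. sum_of_squares (\<sigma> k)"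
      and eq: "\<rho> $ j * partial_derivative p j z =
                 \<sigma>0 z + (\<Sum>k\<in>UNIV. \<sigma> k z * (bp $ k - z $ k) * (z $ k - bm $ k))"
      using cert \<open>\<rho> $ j \<noteq> 0\<close> unfolding has_sos_monotonicity_certificate_def by blast
    have "\<sigma> k z * (bp $ k - z $ k) * (z $ k - bm $ k) \<ge> 0" for k
      using s(2)[of k] \<open>z \<in> ?B\<close> by (auto simp: mult.assoc constraint_box_def sum_of_squares_def sum_nonneg)
    moreover have "\<sigma>0 z \<ge> 0" using s(1) by (auto simp: sum_of_squares_def sum_nonneg)
    ultimately show ?thesis by (simp add: eq sum_nonneg)
  qed
  have mono: "\<rho> $ j * p x \<le> \<rho> $ j * p y"
    if "\<rho> $ j \<noteq> 0" "x \<in> ?B" "y \<in> ?B" "\<forall>i. i \<noteq> j \<longrightarrow> x $ i = y $ i" "x $ j \<le> y $ j" for j x y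
  proof -
    define z where "z = (\<lambda>t. x + t *\<^sub>R axis j 1)"
    have y: "z (y $ j - x $ j) = y"
      using that(4) by (auto simp: vec_eq_iff z_def axis_def)
    have zB: "z t \<in> ?B" if "0 \<le> t" "t \<le> y $ j - x $ j" for t
    proof -
      have "z t $ i \<in> {bm $ i..bp $ i}" for i
      proof -
        have "x $ i \<in> {bm $ i..bp $ i}" "y $ i \<in> {bm $ i..bp $ i}"
          using \<open>x \<in> ?B\<close> \<open>y \<in> ?B\<close> by (auto simp: mem_constraint_box[OF bounds])
        then show ?thesis using that by (auto simp: z_def axis_def)
      qed
      then show ?thesis by (simp add: mem_constraint_box[OF bounds])
    qed
    have "((\<lambda>t. \<rho> $ j * p (z t)) has_real_derivative \<rho> $ j * partial_derivative p j (z t)) (at t)" for t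
      unfolding z_def by (intro DERIV_cmult DERIV_along_axis poly)
    then have "\<rho> $ j * p (z 0) \<le> \<rho> $ j * p (z (y $ j - x $ j))"
      using nonneg[OF \<open>\<rho> $ j \<noteq> 0\<close>] zB that(5)
      by (intro DERIV_nonneg_imp_nondecreasing[where f = "\<lambda>t. \<rho> $ j * p (z t)"]) auto
    then show ?thesis by (simp add: y) (simp add: z_def)
  qed
  show ?thesis
    unfolding has_monotonicity_profile_def increasing_wrt_def decreasing_wrt_def
  proof (intro allI conjI impI ballI)
    fix j x y
    assume "x \<in> ?B" "y \<in> ?B" "(\<forall>i. i \<noteq> j \<longrightarrow> x $ i = y $ i) \<and> x $ j \<le> y $ j"
    then have "\<rho> $ j * p x \<le> \<rho> $ j * p y" if "\<rho> $ j \<noteq> 0"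
      using mono that by blast
    then show "\<rho> $ j = 1 \<Longrightarrow> p x \<le> p y" "\<rho> $ j = -1 \<Longrightarrow> p y \<le> p x" by auto
  qed
qed

section \<open>Tensor products of univariate weights\<close>

text \<open>
Abel summation, with \<open>c (-1)\<close> read as 0. The resulting coefficients are nonnegative if and only if
\<open>c\<close> starts nonnegative and increases.
\<close>

lemma sum_by_parts_tail_sums:
  fixes c v :: "nat \<Rightarrow> 'a::comm_ring"
  shows "(\<Sum>k<N. c k * v k) = (\<Sum>k<N. (c k - (if k = 0 then 0 else c (k - 1))) * (\<Sum>l=k..<N. v l))"
proof (induction N)
  case (Suc N)
  define d where "d k = c k - (if k = 0 then 0 else c (k - 1))" for k
  have d: "(\<Sum>k<Suc N. d k) = c N" for N by (induction N) (auto simp: d_def)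
  have "(\<Sum>k<Suc N. d k * (\<Sum>l=k..<Suc N. v l)) = (\<Sum>k<Suc N. d k * (\<Sum>l=k..<N. v l) + d k * v N)"
    by (intro sum.cong refl) (simp add: distrib_left)
  also have "\<dots> = (\<Sum>k<N. d k * (\<Sum>l=k..<N. v l)) + c N * v N"
    unfolding sum.distrib sum_distrib_right[symmetric] d by simp
  finally show ?case using Suc.IH by (simp add: d_def)
qed simp

definition tensor_sum ::
    "('n::finite \<Rightarrow> nat) \<Rightarrow> ('n \<Rightarrow> nat \<Rightarrow> real poly) \<Rightarrow> (('n \<Rightarrow> nat) \<Rightarrow> real) \<Rightarrow> real ^ 'n \<Rightarrow> real" where
  "tensor_sum N w c x = (\<Sum>\<kappa>\<in>PiE UNIV (\<lambda>i. {..<N i}). c \<kappa> * (\<Prod>i\<in>UNIV. poly (w i (\<kappa> i)) (x $ i)))"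

lemma real_polynomial_function_tensor_sum:
  fixes c :: "('n::finite \<Rightarrow> nat) \<Rightarrow> real"
  shows "real_polynomial_function (tensor_sum N w c)"
proof -
  have "real_polynomial_function (\<lambda>x::real^'n. poly q (x $ i))" for q i
    by (induction q) (auto intro!: real_polynomial_function.intros(2-4) real_polynomial_function_component)
  then show ?thesis
    unfolding tensor_sum_def
    by (intro real_polynomial_function_sum real_polynomial_function.intros(2,4)
        real_polynomial_function_prod finite_PiE) auto
qed

text \<open>
Only the factor in coordinate \<open>j\<close> is differentiated; the terms are grouped by the indices in the
other coordinates so that the inner sum is a polynomial in \<open>x $ j\<close> alone.
\<close>

lemma partial_derivative_tensor_sum:
  fixes N :: "'n::finite \<Rightarrow> nat" and w :: "'n \<Rightarrow> nat \<Rightarrow> real poly"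
  shows "partial_derivative (\<lambda>x. tensor_sum N w c x - C) j x =
    (\<Sum>\<kappa>\<in>PiE (UNIV - {j}) (\<lambda>i. {..<N i}). (\<Prod>i\<in>UNIV - {j}. poly (w i (\<kappa> i)) (x $ i)) *
       (\<Sum>k<N j. c (\<kappa>(j := k)) * poly (pderiv (w j k)) (x $ j)))"
proof -
  let ?p = "\<lambda>x. tensor_sum N w c x - C"
  let ?D = "\<Sum>\<kappa>\<in>PiE UNIV (\<lambda>i. {..<N i}). c \<kappa> * (poly (pderiv (w j (\<kappa> j))) (x $ j) *
                (\<Prod>i\<in>UNIV - {j}. poly (w i (\<kappa> i)) (x $ i)))"
  have "real_polynomial_function ?p"
    by (intro real_polynomial_function_diff real_polynomial_function_tensor_sum
        real_polynomial_function.intros(2))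
  from DERIV_along_axis[OF this, of x j 0]
  have "((\<lambda>t. ?p (x + t *\<^sub>R axis j 1)) has_real_derivative partial_derivative ?p j x) (at 0)"
    by simp
  moreover have "((\<lambda>t. ?p (x + t *\<^sub>R axis j 1)) has_real_derivative ?D) (at 0)"
  proof -
    have "(\<Prod>i\<in>UNIV. poly (w i (\<kappa> i)) ((x + t *\<^sub>R axis j 1) $ i)) =
        poly (w j (\<kappa> j)) (x $ j + t) * (\<Prod>i\<in>UNIV - {j}. poly (w i (\<kappa> i)) (x $ i))" for \<kappa> t
      by (subst prod.remove[of UNIV j]) (auto simp: axis_def intro!: prod.cong)
    then have eq: "?p (x + t *\<^sub>R axis j 1) = (\<Sum>\<kappa>\<in>PiE UNIV (\<lambda>i. {..<N i}). c \<kappa> *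
        (poly (w j (\<kappa> j)) (x $ j + t) * (\<Prod>i\<in>UNIV - {j}. poly (w i (\<kappa> i)) (x $ i)))) - C" for t
      by (simp add: tensor_sum_def)
    have "((\<lambda>t. poly q (x $ j + t)) has_real_derivative poly (pderiv q) (x $ j)) (at 0)" for q
      using DERIV_shift[of "poly q" "poly (pderiv q) (x $ j)" 0 "x $ j"] poly_DERIV[of q "x $ j"]
      by (simp add: add.commute)
    from DERIV_cmult[OF DERIV_cmult_right[OF this]]
    have "((\<lambda>t. \<Sum>\<kappa>\<in>PiE UNIV (\<lambda>i. {..<N i}). c \<kappa> *
        (poly (w j (\<kappa> j)) (x $ j + t) * (\<Prod>i\<in>UNIV - {j}. poly (w i (\<kappa> i)) (x $ i))))
        has_real_derivative ?D) (at 0)"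
      by (rule DERIV_sum)
    from DERIV_diff[OF this DERIV_const[of C]]
    have "((\<lambda>t. (\<Sum>\<kappa>\<in>PiE UNIV (\<lambda>i. {..<N i}). c \<kappa> *
        (poly (w j (\<kappa> j)) (x $ j + t) * (\<Prod>i\<in>UNIV - {j}. poly (w i (\<kappa> i)) (x $ i)))) - C)
        has_real_derivative ?D - 0) (at 0)" .
    then show ?thesis by (simp only: eq diff_0_right)
  qed
  ultimately have "partial_derivative ?p j x = ?D" by (rule DERIV_unique)
  also have "?D = (\<Sum>(k, \<kappa>)\<in>{..<N j} \<times> PiE (UNIV - {j}) (\<lambda>i. {..<N i}).
      c (\<kappa>(j := k)) * (poly (pderiv (w j k)) (x $ j) * (\<Prod>i\<in>UNIV - {j}. poly (w i (\<kappa> i)) (x $ i))))"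
  proof -
    have set: "PiE UNIV (\<lambda>i. {..<N i}) =
        (\<lambda>(k, \<kappa>). \<kappa>(j := k)) ` ({..<N j} \<times> PiE (UNIV - {j}) (\<lambda>i. {..<N i}))"
      using PiE_insert_eq[of j "UNIV - {j}" "\<lambda>i. {..<N i}"] by (simp add: insert_absorb)
    have inj: "inj_on (\<lambda>(k, \<kappa>). \<kappa>(j := k)) ({..<N j} \<times> PiE (UNIV - {j}) (\<lambda>i. {..<N i}))"
      using inj_combinator[of j "UNIV - {j}" "\<lambda>i. {..<N i}"] by simp
    have off: "(\<Prod>i\<in>UNIV - {j}. poly (w i ((\<kappa>(j := k)) i)) (x $ i)) =
        (\<Prod>i\<in>UNIV - {j}. poly (w i (\<kappa> i)) (x $ i))" for k \<kappa>
      by (intro prod.cong) auto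
    show ?thesis
      unfolding set sum.reindex[OF inj] o_def case_prod_beta off fun_upd_same ..
  qed
  also have "\<dots> = (\<Sum>\<kappa>\<in>PiE (UNIV - {j}) (\<lambda>i. {..<N i}). \<Sum>k<N j.
      c (\<kappa>(j := k)) * (poly (pderiv (w j k)) (x $ j) * (\<Prod>i\<in>UNIV - {j}. poly (w i (\<kappa> i)) (x $ i))))"
    unfolding sum.cartesian_product[symmetric] by (rule sum.swap)
  finally show ?thesis by (simp add: sum_distrib_left mult_ac)
qed

text \<open>
Summation by parts writes the inner univariate sum as a combination of derivatives of tail sums,
with nonnegative coefficients because \<open>c\<close> is nonnegative and increases along coordinate \<open>j\<close>. So
the inner sum has an interval certificate in \<open>x $ j\<close>, and the outer factors, being products of
polynomials that are nonnegative everywhere, are sums of squares. No product of two different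
constraints arises, and only the multiplier of constraint \<open>j\<close> is nonzero.
\<close>

lemma tensor_sum_certificate:
  fixes N :: "'n::finite \<Rightarrow> nat" and w :: "'n \<Rightarrow> nat \<Rightarrow> real poly" and bm bp :: "real ^ 'n"
  assumes w: "\<And>i k t. k < N i \<Longrightarrow> poly (w i k) t \<ge> 0"
    and tail: "\<And>k. k < N j \<Longrightarrow>
      (\<lambda>t. s * (\<Sum>l=k..<N j. poly (pderiv (w j l)) t)) \<in> interval_quadratic_module (bm $ j) (bp $ j)"
    and c_nonneg: "\<And>\<kappa>. \<kappa> \<in> PiE UNIV (\<lambda>i. {..<N i}) \<Longrightarrow> c \<kappa> \<ge> 0"
    and c_mono: "\<And>\<kappa> k. \<kappa> \<in> PiE UNIV (\<lambda>i. {..<N i}) \<Longrightarrow> k \<le> \<kappa> j \<Longrightarrow> c (\<kappa>(j := k)) \<le> c \<kappa>"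
  shows "\<exists>(\<sigma>0 :: real ^ 'n \<Rightarrow> real) \<sigma>. sum_of_squares \<sigma>0 \<and> (\<forall>k. sum_of_squares (\<sigma> k)) \<and>
    (\<forall>x. s * partial_derivative (\<lambda>x. tensor_sum N w c x - C) j x =
       \<sigma>0 x + (\<Sum>k\<in>UNIV. \<sigma> k x * (bp $ k - x $ k) * (x $ k - bm $ k)))"
proof -
  define R where "R = PiE (UNIV - {j}) (\<lambda>i. {..<N i})"
  have "finite R" unfolding R_def by (intro finite_PiE) auto
  define P where "P \<kappa> x = (\<Prod>i\<in>UNIV - {j}. poly (w i (\<kappa> i)) (x $ i))" for \<kappa> and x :: "real ^ 'n"
  define q where "q \<kappa> t = s * (\<Sum>k<N j. c (\<kappa>(j := k)) * poly (pderiv (w j k)) t)" for \<kappa> t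
  have P: "sum_of_squares (P \<kappa>)" if "\<kappa> \<in> R" for \<kappa>
    unfolding P_def using that w
    by (intro sum_of_squares_prod sum_of_squares_nonneg_poly) (auto simp: R_def PiE_iff)
  have "q \<kappa> \<in> interval_quadratic_module (bm $ j) (bp $ j)" if "\<kappa> \<in> R" for \<kappa>
  proof -
    have mem: "\<kappa>(j := k) \<in> PiE UNIV (\<lambda>i. {..<N i})" if "k < N j" for k
      using that \<open>\<kappa> \<in> R\<close> by (auto simp: R_def PiE_iff)
    have "c (\<kappa>(j := k)) - (if k = 0 then 0 else c (\<kappa>(j := k - 1))) \<ge> 0" if "k < N j" for k
      using c_nonneg[OF mem[OF that]] c_mono[OF mem[OF that], of "k - 1"] by (cases k) auto
    then have "(\<lambda>t. \<Sum>k<N j. (c (\<kappa>(j := k)) - (if k = 0 then 0 else c (\<kappa>(j := k - 1)))) *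
        (s * (\<Sum>l=k..<N j. poly (pderiv (w j l)) t))) \<in> interval_quadratic_module (bm $ j) (bp $ j)"
      by (intro interval_qm_sum interval_qm_mult interval_qm_const tail) auto
    moreover have "q \<kappa> = (\<lambda>t. \<Sum>k<N j. (c (\<kappa>(j := k)) - (if k = 0 then 0 else c (\<kappa>(j := k - 1)))) *
        (s * (\<Sum>l=k..<N j. poly (pderiv (w j l)) t)))"
      unfolding q_def sum_by_parts_tail_sums[of "\<lambda>k. c (\<kappa>(j := k))"]
      by (simp add: sum_distrib_left[of s "\<lambda>k. _ k * _ k"] mult.left_commute[of s])
    ultimately show ?thesis by simp
  qed
  then have "\<forall>\<kappa>\<in>R. \<exists>\<alpha> \<beta>. (\<forall>t. poly \<alpha> t \<ge> 0) \<and> (\<forall>t. poly \<beta> t \<ge> 0) \<and>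
      (\<forall>t. q \<kappa> t = poly \<alpha> t + poly \<beta> t * ((bp $ j - t) * (t - bm $ j)))"
    unfolding interval_quadratic_module_def by blast
  then obtain \<alpha> \<beta> :: "('n \<Rightarrow> nat) \<Rightarrow> real poly" where
    \<alpha>\<beta>: "\<forall>\<kappa>\<in>R. (\<forall>t. poly (\<alpha> \<kappa>) t \<ge> 0) \<and> (\<forall>t. poly (\<beta> \<kappa>) t \<ge> 0) \<and>
      (\<forall>t. q \<kappa> t = poly (\<alpha> \<kappa>) t + poly (\<beta> \<kappa>) t * ((bp $ j - t) * (t - bm $ j)))"
    by metis
  define \<sigma>0 where "\<sigma>0 x = (\<Sum>\<kappa>\<in>R. P \<kappa> x * poly (\<alpha> \<kappa>) (x $ j))" for x
  define \<tau> where "\<tau> x = (\<Sum>\<kappa>\<in>R. P \<kappa> x * poly (\<beta> \<kappa>) (x $ j))" for x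
  define \<sigma> where "\<sigma> k = (if k = j then \<tau> else (\<lambda>x. 0))" for k
  have "sum_of_squares \<sigma>0" "sum_of_squares \<tau>"
    unfolding \<sigma>0_def \<tau>_def using \<alpha>\<beta> P \<open>finite R\<close>
    by (auto intro!: sum_of_squares_sum sum_of_squares_mult sum_of_squares_nonneg_poly)
  moreover have "sum_of_squares (\<sigma> k)" for k
    using \<open>sum_of_squares \<tau>\<close> by (simp add: \<sigma>_def sum_of_squares_const)
  moreover have "s * partial_derivative (\<lambda>x. tensor_sum N w c x - C) j x =
       \<sigma>0 x + (\<Sum>k\<in>UNIV. \<sigma> k x * (bp $ k - x $ k) * (x $ k - bm $ k))" for x
  proof -
    have "(\<Sum>k\<in>UNIV. \<sigma> k x * (bp $ k - x $ k) * (x $ k - bm $ k)) = \<tau> x * (bp $ j - x $ j) * (x $ j - bm $ j)"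
      by (subst sum.remove[of UNIV j]) (auto simp: \<sigma>_def)
    moreover have "s * partial_derivative (\<lambda>x. tensor_sum N w c x - C) j x = (\<Sum>\<kappa>\<in>R. P \<kappa> x * q \<kappa> (x $ j))"
      unfolding partial_derivative_tensor_sum by (simp add: R_def P_def q_def sum_distrib_left mult_ac)
    moreover have "\<dots> = (\<Sum>\<kappa>\<in>R. P \<kappa> x * poly (\<alpha> \<kappa>) (x $ j)
        + P \<kappa> x * poly (\<beta> \<kappa>) (x $ j) * ((bp $ j - x $ j) * (x $ j - bm $ j)))"
      using \<alpha>\<beta> by (intro sum.cong refl) (simp add: distrib_left)
    ultimately show ?thesis
      by (simp add: sum.distrib \<sigma>0_def \<tau>_def sum_distrib_right mult.assoc)
  qed
  ultimately show ?thesis by blast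
qed

section \<open>Uniform approximation\<close>

text \<open>
Korovkin's argument. A continuous \<open>F\<close> on a compact box satisfies
\<open>\<bar>F z - F x\<bar> \<le> \<epsilon>/2 + L (dist z x)\<^sup>2\<close>, and a positive operator only has to be controlled on the
constants and on the squared distance: the former through the total mass of the weights, the latter
through their second moments, both of which factor over the coordinates.
\<close>

lemma tensor_sum_approximates:
  fixes F :: "real ^ 'n \<Rightarrow> real"
  assumes bounds: "\<And>i. bm $ i \<le> bp $ i" and "compact (constraint_box bm bp)"
    and cont: "continuous_on (constraint_box bm bp) F"
    and K: "\<And>x. x \<in> constraint_box bm bp \<Longrightarrow> \<bar>F x\<bar> \<le> K" and "\<epsilon> > 0"
  shows "\<exists>\<eta>>0. \<forall>s N y w. (\<forall>i. monotone_quasi_partition (s i) (bm $ i) (bp $ i) \<eta> (N i) (y i) (w i)) \<longrightarrow>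
     (\<forall>x\<in>constraint_box bm bp. \<bar>tensor_sum N w (\<lambda>\<kappa>. F (\<chi> i. y i (\<kappa> i))) x - F x\<bar> \<le> \<epsilon>)"
proof -
  let ?B = "constraint_box bm bp"
  have "bm \<in> ?B" using bounds by (simp add: mem_constraint_box)
  then have "K \<ge> 0" using K[of bm] by simp
  have "uniformly_continuous_on ?B F"
    by (rule compact_uniformly_continuous[OF cont assms(2)])
  then obtain \<delta> where "\<delta> > 0" and \<delta>: "\<And>x z. x \<in> ?B \<Longrightarrow> z \<in> ?B \<Longrightarrow> dist z x < \<delta> \<Longrightarrow> dist (F z) (F x) < \<epsilon> / 2"
    using \<open>\<epsilon> > 0\<close> unfolding uniformly_continuous_on_def by (metis half_gt_zero)
  define L where "L = 2 * K / \<delta>\<^sup>2"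
  have "L \<ge> 0" using \<open>K \<ge> 0\<close> by (simp add: L_def)
  have modulus: "\<bar>F z - F x\<bar> \<le> \<epsilon> / 2 + L * (\<Sum>i\<in>UNIV. (z $ i - x $ i)\<^sup>2)" if "x \<in> ?B" "z \<in> ?B" for x z
  proof (cases "dist z x < \<delta>")
    case True
    have "L * (\<Sum>i\<in>UNIV. (z $ i - x $ i)\<^sup>2) \<ge> 0" using \<open>L \<ge> 0\<close> by (simp add: sum_nonneg)
    then show ?thesis using \<delta>[OF that True] by (simp add: dist_real_def)
  next
    case False
    have "\<delta>\<^sup>2 \<le> (dist z x)\<^sup>2" using False \<open>\<delta> > 0\<close> by (intro power_mono) auto
    also have "(dist z x)\<^sup>2 = (\<Sum>i\<in>UNIV. (z $ i - x $ i)\<^sup>2)"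
      unfolding dist_norm power2_norm_eq_inner by (simp add: inner_vec_def power2_eq_square)
    finally have "L * \<delta>\<^sup>2 \<le> L * (\<Sum>i\<in>UNIV. (z $ i - x $ i)\<^sup>2)"
      using \<open>L \<ge> 0\<close> by (rule mult_left_mono)
    moreover have "L * \<delta>\<^sup>2 = 2 * K" using \<open>\<delta> > 0\<close> by (simp add: L_def)
    moreover have "\<bar>F z - F x\<bar> \<le> 2 * K" using K[OF that(1)] K[OF that(2)] by simp
    ultimately show ?thesis using \<open>\<epsilon> > 0\<close> by simp
  qed
  define n where "n = real CARD('n)"
  define \<eta> where "\<eta> = \<epsilon> / 2 / (n * (L + K) + 1)"
  have den: "n * (L + K) + 1 > 0" using \<open>L \<ge> 0\<close> \<open>K \<ge> 0\<close>
    by (intro add_nonneg_pos mult_nonneg_nonneg add_nonneg_nonneg) (auto simp: n_def)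
  have "\<eta> > 0" using den \<open>\<epsilon> > 0\<close> by (simp add: \<eta>_def)
  have budget: "L * (n * \<eta>) + K * (n * \<eta>) \<le> \<epsilon> / 2"
  proof -
    have "L * (n * \<eta>) + K * (n * \<eta>) = (n * (L + K)) * \<eta>" by (simp add: algebra_simps)
    also have "\<dots> \<le> (n * (L + K) + 1) * \<eta>" using \<open>\<eta> > 0\<close> by (intro mult_right_mono) auto
    also have "\<dots> = \<epsilon> / 2"
      using den unfolding \<eta>_def by (metis less_irrefl nonzero_eq_divide_eq mult.commute)
    finally show ?thesis .
  qed
  have "\<bar>tensor_sum N w (\<lambda>\<kappa>. F (\<chi> i. y i (\<kappa> i))) x - F x\<bar> \<le> \<epsilon>"
    if part: "\<And>i. monotone_quasi_partition (s i) (bm $ i) (bp $ i) \<eta> (N i) (y i) (w i)" and x: "x \<in> ?B"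
    for s N y w x
  proof -
    define D where "D = PiE UNIV (\<lambda>i. {..<N i})"
    define W where "W \<kappa> = (\<Prod>i\<in>UNIV. poly (w i (\<kappa> i)) (x $ i))" for \<kappa>
    define Y where "Y \<kappa> = (\<chi> i. y i (\<kappa> i))" for \<kappa>
    define S where "S i = (\<Sum>k<N i. poly (w i k) (x $ i))" for i
    have xi: "x $ i \<in> {bm $ i..bp $ i}" for i using x by (simp add: mem_constraint_box bounds)
    have w: "poly (w i k) t \<ge> 0" and y: "y i k \<in> {bm $ i..bp $ i}" if "k < N i" for i k t
      using part[of i] that by (auto simp: monotone_quasi_partition_def)
    have S: "S i \<in> {1 - \<eta>..1}" and V: "(\<Sum>k<N i. poly (w i k) (x $ i) * (y i k - x $ i)\<^sup>2) \<le> \<eta>" for i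
      using part[of i] xi[of i] unfolding monotone_quasi_partition_def S_def by blast+
    have S0: "S i \<ge> 0" for i unfolding S_def by (intro sum_nonneg w) auto
    have V0: "(\<Sum>k<N i. poly (w i k) (x $ i) * (y i k - x $ i)\<^sup>2) \<ge> 0" for i
      by (intro sum_nonneg mult_nonneg_nonneg w) auto
    have YB: "Y \<kappa> \<in> ?B" if "\<kappa> \<in> D" for \<kappa>
      using that y by (auto simp: mem_constraint_box bounds Y_def D_def PiE_iff)
    have W0: "W \<kappa> \<ge> 0" if "\<kappa> \<in> D" for \<kappa>
      unfolding W_def using that w by (intro prod_nonneg) (auto simp: D_def PiE_iff)
    have mass: "(\<Sum>\<kappa>\<in>D. W \<kappa>) = (\<Prod>i\<in>UNIV. S i)"
      unfolding D_def W_def S_def by (rule prod_sum_PiE[symmetric]) auto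
    have mass_le: "(\<Sum>\<kappa>\<in>D. W \<kappa>) \<le> 1"
      unfolding mass using S S0 by (intro prod_le_1) auto
    have mass_ge: "\<bar>(\<Sum>\<kappa>\<in>D. W \<kappa>) - 1\<bar> \<le> n * \<eta>"
    proof -
      have "norm ((\<Prod>i\<in>UNIV. S i) - (\<Prod>i\<in>(UNIV :: 'n set). 1)) \<le> (\<Sum>i\<in>UNIV. norm (S i - 1))"
        using S S0 by (intro norm_prod_diff) auto
      also have "\<dots> \<le> (\<Sum>i\<in>(UNIV :: 'n set). \<eta>)"
      proof (intro sum_mono)
        show "norm (S i - 1) \<le> \<eta>" for i using S[of i] by (auto simp: abs_le_iff)
      qed
      finally show ?thesis by (simp add: mass n_def)
    qed
    have moment: "(\<Sum>\<kappa>\<in>D. W \<kappa> * (Y \<kappa> $ j - x $ j)\<^sup>2) \<le> \<eta>" for j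
    proof -
      let ?g = "\<lambda>i k. poly (w i k) (x $ i) * (if i = j then (y i k - x $ i)\<^sup>2 else 1)"
      have "(\<Sum>\<kappa>\<in>D. W \<kappa> * (Y \<kappa> $ j - x $ j)\<^sup>2) = (\<Sum>\<kappa>\<in>D. \<Prod>i\<in>UNIV. ?g i (\<kappa> i))"
        by (simp add: W_def Y_def prod.distrib)
      also have "\<dots> = (\<Prod>i\<in>UNIV. \<Sum>k<N i. ?g i k)"
        unfolding D_def by (rule prod_sum_PiE[symmetric]) auto
      also have "\<dots> = (\<Sum>k<N j. poly (w j k) (x $ j) * (y j k - x $ j)\<^sup>2) * (\<Prod>i\<in>UNIV - {j}. S i)"
        by (subst prod.remove[of UNIV j]) (auto simp: S_def intro!: prod.cong)
      also have "\<dots> \<le> \<eta> * 1"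
        using S S0 V V0 \<open>\<eta> > 0\<close> by (intro mult_mono prod_le_1 prod_nonneg) auto
      finally show ?thesis by simp
    qed
    have "tensor_sum N w (\<lambda>\<kappa>. F (\<chi> i. y i (\<kappa> i))) x - F x
        = (\<Sum>\<kappa>\<in>D. W \<kappa> * (F (Y \<kappa>) - F x)) + F x * ((\<Sum>\<kappa>\<in>D. W \<kappa>) - 1)"
      by (simp add: tensor_sum_def D_def W_def Y_def sum_subtractf sum_distrib_left algebra_simps)
    also have "\<bar>\<dots>\<bar> \<le> \<bar>\<Sum>\<kappa>\<in>D. W \<kappa> * (F (Y \<kappa>) - F x)\<bar> + K * (n * \<eta>)"
      using mult_mono[OF K[OF x] mass_ge] \<open>K \<ge> 0\<close> by (intro order_trans[OF abs_triangle_ineq]) (simp add: abs_mult)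
    also have "\<bar>\<Sum>\<kappa>\<in>D. W \<kappa> * (F (Y \<kappa>) - F x)\<bar>
        \<le> (\<Sum>\<kappa>\<in>D. W \<kappa> * (\<epsilon> / 2 + L * (\<Sum>i\<in>UNIV. (Y \<kappa> $ i - x $ i)\<^sup>2)))"
      using W0 modulus[OF x YB] by (intro order_trans[OF sum_abs] sum_mono) (auto simp: abs_mult intro!: mult_left_mono)
    also have "\<dots> = (\<Sum>\<kappa>\<in>D. W \<kappa>) * (\<epsilon> / 2) + L * (\<Sum>i\<in>UNIV. \<Sum>\<kappa>\<in>D. W \<kappa> * (Y \<kappa> $ i - x $ i)\<^sup>2)"
      by (subst sum.swap) (simp add: distrib_left sum.distrib sum_distrib_left sum_distrib_right mult_ac)
    also have "\<dots> \<le> 1 * (\<epsilon> / 2) + L * (\<Sum>i\<in>(UNIV :: 'n set). \<eta>)"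
      using mass_le moment \<open>\<epsilon> > 0\<close> \<open>L \<ge> 0\<close> by (intro add_mono mult_right_mono mult_left_mono sum_mono) auto
    finally show ?thesis using budget by (simp add: n_def)
  qed
  then show ?thesis using \<open>\<eta> > 0\<close> by blast
qed

section \<open>Monotone approximation with certificates\<close>

theorem theorem8p4p1:
  fixes f :: "real ^ 'n \<Rightarrow> real" and bm bp \<rho> :: "real ^ 'n" and \<epsilon> :: real
  assumes "\<And>i. bm $ i \<le> bp $ i"
    and "\<And>j. \<rho> $ j \<in> {-1, 0, 1}"
    and "C1_function f"
    and "has_monotonicity_profile (constraint_box bm bp) \<rho> f"
    and "\<epsilon> > 0"
  shows "\<exists>(d :: nat) p.
           real_polynomial_function p \<and> has_total_degree p d \<and>
           (SUP x\<in>constraint_box bm bp. \<bar>f x - p x\<bar>) < \<epsilon> \<and>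
           has_monotonicity_profile (constraint_box bm bp) \<rho> p \<and>
           has_sos_monotonicity_certificate bm bp \<rho> p"
proof -
  let ?B = "constraint_box bm bp"
  have "?B = cbox bm bp"
    by (auto simp: mem_constraint_box assms(1) mem_box_cart)
  then have "compact ?B" by simp
  have "bm \<in> ?B" using assms(1) by (simp add: mem_constraint_box)
  have cont: "continuous_on ?B f"
    using assms(3) unfolding C1_function_def
    by (meson has_derivative_continuous continuous_at_imp_continuous_on)
  then have "bounded (f ` ?B)"
    using \<open>compact ?B\<close> by (intro compact_imp_bounded compact_continuous_image)
  then obtain M where M: "\<And>x. x \<in> ?B \<Longrightarrow> \<bar>f x\<bar> \<le> M"
    by (auto simp: bounded_iff)
  \<comment> \<open>Adding M makes the node values nonnegative, as the first term of the summation by parts requires.\<close>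
  define F where "F x = f x + M" for x
  have F0: "F x \<ge> 0" if "x \<in> ?B" for x using M[OF that] by (simp add: F_def)
  have FK: "\<bar>F x\<bar> \<le> 2 * M" if "x \<in> ?B" for x using M[OF that] by (simp add: F_def)
  have "continuous_on ?B F" unfolding F_def by (intro continuous_intros cont)
  from tensor_sum_approximates[OF assms(1) \<open>compact ?B\<close> this FK, of "\<epsilon> / 2"] \<open>\<epsilon> > 0\<close>
  obtain \<eta> where "\<eta> > 0" and approx:
    "\<forall>s N y w. (\<forall>i. monotone_quasi_partition (s i) (bm $ i) (bp $ i) \<eta> (N i) (y i) (w i)) \<longrightarrow>
     (\<forall>x\<in>?B. \<bar>tensor_sum N w (\<lambda>\<kappa>. F (\<chi> i. y i (\<kappa> i))) x - F x\<bar> \<le> \<epsilon> / 2)"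
    by auto
  \<comment> \<open>Coordinates without a requirement may carry either orientation.\<close>
  define s where "s i = (if \<rho> $ i = -1 then -1 else 1 :: real)" for i
  have "\<forall>i. \<exists>N y w. monotone_quasi_partition (s i) (bm $ i) (bp $ i) \<eta> N y w"
    using assms(1) \<open>\<eta> > 0\<close> by (auto intro!: monotone_quasi_partition_exists simp: s_def)
  then obtain N y w where
    part: "\<forall>i. monotone_quasi_partition (s i) (bm $ i) (bp $ i) \<eta> (N i) (y i) (w i)"
    by metis
  define c where "c \<kappa> = F (\<chi> i. y i (\<kappa> i))" for \<kappa>
  define p where "p x = tensor_sum N w c x - M" for x
  have node: "(\<chi> i. y i (\<kappa> i)) \<in> ?B" if "\<kappa> \<in> PiE UNIV (\<lambda>i. {..<N i})" for \<kappa>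
    using that part by (auto simp: mem_constraint_box assms(1) monotone_quasi_partition_def PiE_iff)
  have poly: "real_polynomial_function p"
    unfolding p_def by (intro real_polynomial_function_diff real_polynomial_function_tensor_sum
        real_polynomial_function.intros(2))
  have cert: "has_sos_monotonicity_certificate bm bp \<rho> p"
    unfolding has_sos_monotonicity_certificate_def p_def
  proof (intro allI impI, rule tensor_sum_certificate)
    fix j assume "\<rho> $ j \<noteq> 0"
    then have \<rho>: "\<rho> $ j = s j" "\<rho> $ j = 1 \<or> \<rho> $ j = -1" using assms(2)[of j] by (auto simp: s_def)
    show "poly (w i k) t \<ge> 0" if "k < N i" for i k t
      using part that by (auto simp: monotone_quasi_partition_def)
    show "(\<lambda>t. \<rho> $ j * (\<Sum>l=k..<N j. poly (pderiv (w j l)) t)) \<in> interval_quadratic_module (bm $ j) (bp $ j)"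
      if "k < N j" for k
      using part that by (auto simp: monotone_quasi_partition_def \<rho>(1))
    fix \<kappa> assume \<kappa>: "\<kappa> \<in> PiE UNIV (\<lambda>i. {..<N i})"
    show "c \<kappa> \<ge> 0" unfolding c_def by (intro F0 node \<kappa>)
    fix k assume k: "k \<le> \<kappa> j"
    have lt: "\<kappa> j < N j" using \<kappa> by (auto simp: PiE_iff)
    have "\<kappa>(j := k) \<in> PiE UNIV (\<lambda>i. {..<N i})" using \<kappa> le_less_trans[OF k lt] by (auto simp: PiE_iff)
    define u where "u = (\<chi> i. y i ((\<kappa>(j := k)) i))"
    define v where "v = (\<chi> i. y i (\<kappa> i))"
    have mem: "u \<in> ?B" "v \<in> ?B"
      unfolding u_def v_def by (intro node \<kappa> \<open>\<kappa>(j := k) \<in> _\<close>)+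
    have off: "\<forall>i. i \<noteq> j \<longrightarrow> u $ i = v $ i" by (simp add: u_def v_def)
    have "s j * y j k \<le> s j * y j (\<kappa> j)"
      using part k lt by (auto simp: monotone_quasi_partition_def)
    then have ord: "\<rho> $ j * u $ j \<le> \<rho> $ j * v $ j" by (simp add: u_def v_def \<rho>(1))
    from \<rho>(2) have "f u \<le> f v"
    proof
      assume 1: "\<rho> $ j = 1"
      then have "increasing_wrt ?B j f" using assms(4) unfolding has_monotonicity_profile_def by blast
      moreover have "u $ j \<le> v $ j" using ord 1 by simp
      ultimately show ?thesis using mem off unfolding increasing_wrt_def by blast
    next
      assume 1: "\<rho> $ j = -1"
      then have "decreasing_wrt ?B j f" using assms(4) unfolding has_monotonicity_profile_def by blast
      moreover have "v $ j \<le> u $ j" using ord 1 by simp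
      moreover have "\<forall>i. i \<noteq> j \<longrightarrow> v $ i = u $ i" using off by simp
      ultimately show ?thesis using mem unfolding decreasing_wrt_def by blast
    qed
    then show "c (\<kappa>(j := k)) \<le> c \<kappa>" unfolding c_def F_def u_def v_def by simp
  qed
  have "\<bar>f x - p x\<bar> \<le> \<epsilon> / 2" if "x \<in> ?B" for x
  proof -
    have "\<bar>tensor_sum N w c x - F x\<bar> \<le> \<epsilon> / 2"
      unfolding c_def using approx part that by blast
    moreover have "f x - p x = - (tensor_sum N w c x - F x)" by (simp add: p_def F_def)
    ultimately show ?thesis by (simp only: abs_minus_cancel)
  qed
  then have "(SUP x\<in>?B. \<bar>f x - p x\<bar>) \<le> \<epsilon> / 2"
    using \<open>bm \<in> ?B\<close> by (intro cSUP_least) auto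
  then have "(SUP x\<in>?B. \<bar>f x - p x\<bar>) < \<epsilon>" using \<open>\<epsilon> > 0\<close> by simp
  then show ?thesis
    using poly cert has_total_degree_exists[OF poly] profile_of_certificate[OF assms(1) poly cert] by blast
qed

end
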